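(* Let $R\ge R_0=\|x^0-x^*\|$ and let $Q=B_{2R}(x^* )$. Assume that - (bounded variance) $\mathbb{E}\|F_\xi(x)-F(x)\|^2\le\sigma^2$ for all $x\in Q$; - (monotonicity) $\langle F(x)-F(y),x-y\rangle\ge0$ for all $x,y\in Q$; - (star-cocoercivity) for some $\ell>0$, $\|F(x)\|^2\le\ell\langle F(x),x-\mathrm{proj}(x)\rangle$ for all $x\in Q$, where $\mathrm{proj}(x)$ is the projection of $x$ onto the solution set $\mathcal X^*$. Let $$\gamma\le\frac1{170\ell\ln\frac{6(K+1)}\beta},\qquad\lambda_k\equiv\lambda=\frac R{60\gamma\ln\frac{6(K+1)}\beta},$$ $$m_k\equiv m\ge\max\left\{1,\frac{97200(K+1)\gamma^2\sigma^2\ln\frac{6(K+1)}\beta}{R^2}\right\}$$ for some $K\ge0$ and $\beta\in(0,1]$ such that $\ln\frac{6(K+1)}\beta\ge1$. Then, after $K$ iterations, the iterates produced by clipped-SGDA with probability at least $1-\beta$ satisfy $$\mathrm{Gap}_R(x^K_{\rm avg})\le\frac{9R^2}{2\gamma(K+1)},\qquad\text{where }x^K_{\rm avg}=\frac1{K+1}\sum_{k=0}^Kx^k.$$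
   Context: Notation: $\|\cdot\|$ is the Euclidean norm, $B_r(x)=\{u\in\mathbb{R}^d:\|u-x\|\le r\}$. $F:\mathbb{R}^d\to\mathbb{R}^d$ with $F(x)=\mathbb{E}_{\xi\sim\mathcal D}[F_\xi(x)]$, where $F_\xi(x)$ is a stochastic oracle. $\mathcal X^*=\{x\in\mathbb{R}^d:F(x)=0\}$ is the solution set, $x^0$ is the starting point, $x^*$ is the projection of $x^0$ onto $\mathcal X^*$. $\mathrm{Gap}_R(x)=\max_{y\in B_R(x^* )}\langle F(y),x-y\rangle$. $\mathrm{clip}(y,\lambda)=\min\{1,\lambda/\|y\|\}y$ for $y\ne0$, $\mathrm{clip}(0,\lambda)=0$, for $\lambda>0$. clipped-SGDA, for $k=0,1,\dots$: $x^{k+1}=x^k-\gamma\widetilde F_{\boldsymbol\xi^k}(x^k)$, $\widetilde F_{\boldsymbol\xi^k}(x^k)=\mathrm{clip}\left(\frac1{m_k}\sum_{i=1}^{m_k}F_{\xi^{i,k}}(x^k),\lambda_k\right)$, where all $\xi^{i,k}$ are independent samples from $\mathcal D$; $\gamma>0$ is the stepsize, $\lambda_k>0$ are clipping levels, $m_k$ are batchsizes. *)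

theory Defs
  imports "HOL-Probability.Probability"
begin

definition clip :: "'a::real_normed_vector \<Rightarrow> real \<Rightarrow> 'a" where
  "clip y c = (if y = 0 then 0 else min 1 (c / norm y) *\<^sub>R y)"

definition solution_set :: "('a::real_normed_vector \<Rightarrow> 'a) \<Rightarrow> 'a set" where
  "solution_set F = {x. F x = 0}"

text \<open>A relation rather than a function: the solution set of an operator that is
  monotone only locally need not be closed or convex, so nearest points may fail to exist
  or to be unique.  Statements assume existence where they need it, and allow any
  choice of nearest point.\<close>
definition is_projection :: "'a::metric_space set \<Rightarrow> 'a \<Rightarrow> 'a \<Rightarrow> bool" where
  "is_projection S x p \<longleftrightarrow> p \<in> S \<and> (\<forall>y\<in>S. dist x p \<le> dist x y)"

text \<open>The maximum over the ball is rendered as a supremum, because \<open>F\<close> is not assumed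
  continuous and the maximum need not be attained.  The real supremum is
  meaningful whenever \<open>F\<close> is bounded on the ball, as it is for star-cocoercive \<open>F\<close>.\<close>
definition gap :: "('a::real_inner \<Rightarrow> 'a) \<Rightarrow> 'a \<Rightarrow> real \<Rightarrow> 'a \<Rightarrow> real" where
  "gap F xstar R x = (SUP y\<in>cball xstar R. F y \<bullet> (x - y))"

text \<open>\<open>Fo z x\<close> is the oracle value at \<open>x\<close> for the sample \<open>z\<close>, and \<open>\<xi> i k \<omega>\<close>
  (\<open>1 \<le> i \<le> m k\<close>) is the \<open>i\<close>-th sample of the batch drawn in iteration \<open>k\<close>.\<close>
primrec clipped_sgda ::
  "('b \<Rightarrow> 'a::real_normed_vector \<Rightarrow> 'a) \<Rightarrow> real \<Rightarrow> (nat \<Rightarrow> real) \<Rightarrow> (nat \<Rightarrow> nat) \<Rightarrow>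
   (nat \<Rightarrow> nat \<Rightarrow> 'w \<Rightarrow> 'b) \<Rightarrow> 'a \<Rightarrow> nat \<Rightarrow> 'w \<Rightarrow> 'a" where
  "clipped_sgda Fo \<gamma> lam m \<xi> x0 0 \<omega> = x0"
| "clipped_sgda Fo \<gamma> lam m \<xi> x0 (Suc k) \<omega> =
     (let x = clipped_sgda Fo \<gamma> lam m \<xi> x0 k \<omega>
      in x - \<gamma> *\<^sub>R clip ((1 / real (m k)) *\<^sub>R (\<Sum>i=1..m k. Fo (\<xi> i k \<omega>) x)) (lam k))"

definition sgda_avg ::
  "('b \<Rightarrow> 'a::real_normed_vector \<Rightarrow> 'a) \<Rightarrow> real \<Rightarrow> (nat \<Rightarrow> real) \<Rightarrow> (nat \<Rightarrow> nat) \<Rightarrow>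
   (nat \<Rightarrow> nat \<Rightarrow> 'w \<Rightarrow> 'b) \<Rightarrow> 'a \<Rightarrow> nat \<Rightarrow> 'w \<Rightarrow> 'a" where
  "sgda_avg Fo \<gamma> lam m \<xi> x0 K \<omega> =
     (1 / real (K + 1)) *\<^sub>R (\<Sum>k=0..K. clipped_sgda Fo \<gamma> lam m \<xi> x0 k \<omega>)"

end

theory Submission
  imports Defs
begin

text \<open>Let \<open>e\<^sub>k\<close> be the oracle error \<open>F x\<^sub>k\<close> minus the clipped batch mean. Star-cocoercivity refers to the
  nearest solution of \<open>x\<^sub>k\<close> and not to \<open>xstar\<close>, so \<open>norm (x\<^sub>k - xstar)\<^sup>2\<close> alone does not bound
  \<open>\<Sum> norm (F x\<^sub>k)\<^sup>2\<close>. Three potentials are followed instead: \<open>norm (x\<^sub>k - xstar)\<^sup>2\<close> keeps the iterates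
  near \<open>xstar\<close>, the squared distance to the solution set bounds \<open>\<gamma>\<^sup>2 \<Sum> norm (F x\<^sub>k)\<^sup>2\<close>, and
  \<open>norm (y\<^sub>k)\<^sup>2\<close> with \<open>y\<^sub>k = \<gamma> \<Sum>\<^bsub>j<k\<^esub> e\<^sub>j\<close> makes the bound on the gap uniform over the ball.
  For each potential the noise contributes increments \<open>2 \<gamma> (e\<^sub>k \<bullet> v\<^sub>k) + \<gamma>\<^sup>2 norm (e\<^sub>k)\<^sup>2\<close> with \<open>v\<^sub>k\<close>
  determined by the past. When the process is frozen on leaving a bounded region, \<open>exp t \<le> 1 + t + t\<^sup>2\<close>
  turns the exponential of their sum into a supermartingale up to a constant factor, and Markov's
  inequality gives three bad events of probability at most \<open>\<beta> / (6 (K + 1))\<close> each; outside of them the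
  process never leaves the region.\<close>

section \<open>Elementary estimates for the exponential and for clipping\<close>

lemma exp_le_quadratic:
  fixes x :: real
  assumes "\<bar>x\<bar> \<le> 1"
  shows "exp x \<le> 1 + x + x\<^sup>2"
proof (cases "x \<ge> 0")
  case True
  then show ?thesis using exp_bound[of x] assms by simp
next
  case False
  \<comment> \<open>\<open>1 - x \<le> exp (- x)\<close> and
    \<open>(1 + x + x\<^sup>2) * (1 - x) = 1 - x ^ 3\<close> reduce the negative case to
    \<open>x ^ 3 \<le> 0\<close>.\<close>
  have "exp x * (1 - x) \<le> exp x * exp (- x)"
    using exp_ge_add_one_self[of "- x"] by (intro mult_left_mono) auto
  also have "\<dots> = 1" by (simp add: exp_minus)
  also have "\<dots> \<le> 1 - x ^ 3"
    using False by (simp add: power3_eq_cube mult_nonneg_nonpos)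
  also have "\<dots> = (1 + x + x\<^sup>2) * (1 - x)"
    by (simp add: algebra_simps power2_eq_square power3_eq_cube)
  finally show ?thesis using False by simp
qed

lemma clip_eq_scaleR: "clip y c = (if norm y \<le> c then y else (c / norm y) *\<^sub>R y)"
  for y :: "'a::real_normed_vector"
  by (auto simp: clip_def min_def divide_simps)

lemma norm_clip_le: "0 \<le> c \<Longrightarrow> norm (clip y c) \<le> c"
  by (auto simp: clip_eq_scaleR)

lemma norm_diff_clip: "0 \<le> c \<Longrightarrow> norm (y - clip y c) = max 0 (norm y - c)"
proof (cases "norm y \<le> c")
  case False
  assume "0 \<le> c"
  then have y: "norm y > 0" using False by linarith
  have "y - (c / norm y) *\<^sub>R y = (1 - c / norm y) *\<^sub>R y" by (simp add: algebra_simps)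
  then have "norm (y - clip y c) = \<bar>1 - c / norm y\<bar> * norm y"
    using False by (simp add: clip_eq_scaleR)
  also have "\<bar>1 - c / norm y\<bar> = 1 - c / norm y" using False y by (simp add: abs_if)
  also have "\<dots> * norm y = norm y - c" using y by (simp add: algebra_simps)
  finally show ?thesis using False by simp
qed (simp add: clip_eq_scaleR)

text \<open>Clipping is the metric projection onto the ball of radius \<open>c\<close>. As
  \<open>f\<close> lies in that ball, the distance to \<open>f\<close> cannot grow.\<close>

lemma norm_clip_diff_le:
  fixes f y :: "'a::real_inner"
  assumes f: "norm f \<le> c"
  shows "norm (clip y c - f) \<le> norm (y - f)"
proof (cases "norm y \<le> c")
  case False
  define t where "t = c / norm y"
  have c: "0 \<le> c" using f norm_ge_zero order_trans by blast
  then have y: "norm y > 0" using False by linarith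
  have t: "0 \<le> t" "t \<le> 1" "c = t * norm y" using y False c by (auto simp: t_def)
  have "y \<bullet> f \<le> norm y * c"
    using Cauchy_Schwarz_ineq2[of y f] mult_left_mono[OF f norm_ge_zero[of y]] by linarith
  then have "y \<bullet> f \<le> norm y * (t * norm y)" unfolding t(3) .
  \<comment> \<open>Since \<open>y \<bullet> f\<close> is at most
    \<open>t * (norm y)\<^sup>2\<close>, the second factor on the right is at least
    \<open>(1 - t) * (norm y)\<^sup>2\<close>.\<close>
  moreover have "(norm (y - f))\<^sup>2 - (norm (t *\<^sub>R y - f))\<^sup>2
      = (1 - t) * ((1 + t) * (norm y)\<^sup>2 - 2 * (y \<bullet> f))"
    by (simp add: power2_norm_eq_inner algebra_simps inner_commute)
  moreover have "0 \<le> (1 - t) * ((1 - t) * (norm y)\<^sup>2)" using t by simp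
  moreover have "(1 - t) * ((1 - t) * (norm y)\<^sup>2)
      \<le> (1 - t) * ((1 + t) * (norm y)\<^sup>2 - 2 * (y \<bullet> f))"
    using t calculation(1) by (intro mult_left_mono) (auto simp: algebra_simps power2_eq_square)
  ultimately have "(norm (t *\<^sub>R y - f))\<^sup>2 \<le> (norm (y - f))\<^sup>2" by linarith
  then show ?thesis using False by (simp add: clip_eq_scaleR t_def)
qed (simp add: clip_eq_scaleR)

lemma borel_measurable_clip [measurable]:
  "(\<lambda>y::'a::euclidean_space. clip y c) \<in> borel_measurable borel"
  unfolding clip_eq_scaleR by measurable

section \<open>Exponential moment of a single clipped step\<close>

text \<open>Clipping bounds \<open>W\<close> by \<open>3 / 2 * c\<close>, so \<open>small\<close>
  puts the exponent into \<open>[-1, 1]\<close>, where the quadratic bound on \<open>exp\<close>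
  applies. In the result \<open>\<gamma> * V * s / c\<close> comes from the bias of clipping,
  \<open>\<gamma>\<^sup>2 * s\<close> from the second moment of \<open>W\<close>, and the
  \<open>\<theta>\<^sup>2\<close> term from the second moment of the whole increment.\<close>

lemma (in prob_space) clip_exp_moment:
  fixes X :: "'a \<Rightarrow> 'v::euclidean_space"
  assumes X: "integrable M X" "expectation X = f"
    and var: "integrable M (\<lambda>w. (norm (X w - f))\<^sup>2)" "expectation (\<lambda>w. (norm (X w - f))\<^sup>2) \<le> s"
    and f: "norm f \<le> c / 2" and c: "0 < c" and v: "norm v \<le> V" and \<gamma>: "0 < \<gamma>" and \<theta>: "0 < \<theta>"
    and small: "\<theta> * (3 * \<gamma> * c * V + (3 / 2 * \<gamma> * c)\<^sup>2) \<le> 1"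
  defines "W \<equiv> \<lambda>w. f - clip (X w) c"
  shows "(\<integral>\<^sup>+w. ennreal (exp (\<theta> * (2 * \<gamma> * (W w \<bullet> v) + \<gamma>\<^sup>2 * (norm (W w))\<^sup>2))) \<partial>M)
     \<le> ennreal (exp (\<theta> * (\<gamma> * V * s / c + \<gamma>\<^sup>2 * s) + \<theta>\<^sup>2 * (\<gamma>\<^sup>2 * s * (2 * V + 3 / 2 * \<gamma> * c)\<^sup>2)))"
proof -
  define Z where "Z = (\<lambda>w. 2 * \<gamma> * (W w \<bullet> v) + \<gamma>\<^sup>2 * (norm (W w))\<^sup>2)"
  have V: "0 \<le> V" using v norm_ge_zero order_trans by blast
  have meas[measurable]: "X \<in> borel_measurable M" using X by auto
  have [measurable]: "W \<in> borel_measurable M" unfolding W_def by measurable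
  have [measurable]: "Z \<in> borel_measurable M" unfolding Z_def by measurable
  have s: "0 \<le> s" using var(2) by (smt (verit) integral_nonneg_AE always_eventually zero_le_power2)
  have W_c: "norm (W w) \<le> 3 / 2 * c" for w
    using norm_triangle_ineq4[of f "clip (X w) c"] norm_clip_le[of c "X w"] f c
    by (simp add: W_def)
  have W_X: "norm (W w) \<le> norm (X w - f)" for w
    using norm_clip_diff_le[of f c "X w"] f c by (simp add: W_def norm_minus_commute)
  have W_X2: "(norm (W w))\<^sup>2 \<le> (norm (X w - f))\<^sup>2" for w
    using W_X[of w] by (intro power_mono) auto
  have Wv: "\<bar>W w \<bullet> v\<bar> \<le> norm (W w) * V" for w
    using Cauchy_Schwarz_ineq2[of "W w" v] mult_left_mono[OF v norm_ge_zero[of "W w"]] by linarith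
  have Z_W: "\<bar>Z w\<bar> \<le> \<gamma> * norm (W w) * (2 * V + 3 / 2 * \<gamma> * c)" for w
  proof -
    have "\<bar>Z w\<bar> \<le> 2 * \<gamma> * \<bar>W w \<bullet> v\<bar> + \<gamma>\<^sup>2 * (norm (W w))\<^sup>2"
      unfolding Z_def using \<gamma> by (intro order_trans[OF abs_triangle_ineq]) (simp add: abs_mult)
    also have "\<dots> \<le> 2 * \<gamma> * (norm (W w) * V) + \<gamma>\<^sup>2 * (norm (W w) * (3 / 2 * c))"
      using \<gamma> Wv[of w] mult_left_mono[OF W_c[of w] norm_ge_zero[of "W w"]]
      by (intro add_mono mult_left_mono) (auto simp: power2_eq_square)
    finally show ?thesis by (simp add: algebra_simps power2_eq_square)
  qed
  have Z_bound: "\<theta> * \<bar>Z w\<bar> \<le> 1" for w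
  proof -
    have "\<gamma> * norm (W w) * (2 * V + 3 / 2 * \<gamma> * c) \<le> \<gamma> * (3 / 2 * c) * (2 * V + 3 / 2 * \<gamma> * c)"
      using \<gamma> V c W_c[of w] by (intro mult_right_mono mult_left_mono) auto
    also have "\<dots> = 3 * \<gamma> * c * V + (3 / 2 * \<gamma> * c)\<^sup>2"
      by (simp add: power2_eq_square algebra_simps)
    finally have "\<theta> * \<bar>Z w\<bar> \<le> \<theta> * (3 * \<gamma> * c * V + (3 / 2 * \<gamma> * c)\<^sup>2)"
      using Z_W[of w] \<theta> by (intro mult_left_mono) auto
    then show ?thesis using small by linarith
  qed
  have Z_b: "\<bar>Z w\<bar> \<le> 1 / \<theta>" for w
    using Z_bound[of w] \<theta> by (simp add: field_simps)
  have Z2: "(Z w)\<^sup>2 \<le> \<gamma>\<^sup>2 * (2 * V + 3 / 2 * \<gamma> * c)\<^sup>2 * (norm (X w - f))\<^sup>2" for w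
  proof -
    have "(Z w)\<^sup>2 \<le> (\<gamma> * norm (W w) * (2 * V + 3 / 2 * \<gamma> * c))\<^sup>2"
      using power_mono[OF Z_W[of w], of 2] by simp
    also have "\<dots> = \<gamma>\<^sup>2 * (2 * V + 3 / 2 * \<gamma> * c)\<^sup>2 * (norm (W w))\<^sup>2"
      by (simp add: power_mult_distrib)
    also have "\<dots> \<le> \<gamma>\<^sup>2 * (2 * V + 3 / 2 * \<gamma> * c)\<^sup>2 * (norm (X w - f))\<^sup>2"
      by (intro mult_left_mono W_X2) auto
    finally show ?thesis .
  qed
  have int_Z: "integrable M Z"
    by (intro integrable_const_bound[where B="1 / \<theta>"]) (auto simp: Z_b)
  have "(Z w)\<^sup>2 \<le> (1 / \<theta>)\<^sup>2" for w using power_mono[OF Z_b[of w], of 2] by simp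
  then have int_Z2: "integrable M (\<lambda>w. (Z w)\<^sup>2)"
    by (intro integrable_const_bound[where B="(1 / \<theta>)\<^sup>2"]) (auto)
  have int_W: "integrable M W"
    by (intro integrable_const_bound[where B="3 / 2 * c"] AE_I2 W_c) measurable
  have "(norm (W w))\<^sup>2 \<le> (3 / 2 * c)\<^sup>2" for w using power_mono[OF W_c[of w], of 2] by simp
  then have int_W2: "integrable M (\<lambda>w. (norm (W w))\<^sup>2)"
    by (intro integrable_const_bound[where B="(3 / 2 * c)\<^sup>2"]) (auto)
  \<comment> \<open>The part cut off is at most \<open>t - c / 2\<close>, because \<open>f\<close>
    uses only half of the level. By \<open>(t - c)\<^sup>2 \<ge> 0\<close> this is quadratic in the
    deviation, so the variance controls the bias.\<close>
  have tail: "norm (X w - clip (X w) c) \<le> (norm (X w - f))\<^sup>2 / (2 * c)" for w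
  proof -
    define t where "t = norm (X w - f)"
    have "norm (X w) \<le> t + c / 2"
      unfolding t_def using norm_triangle_sub[of "X w" f] f by linarith
    moreover have "t - c / 2 \<le> t\<^sup>2 / (2 * c)"
      using c zero_le_power2[of "t - c"] by (simp add: field_simps power2_eq_square)
    ultimately have "norm (X w) - c \<le> t\<^sup>2 / (2 * c)" by linarith
    moreover have "0 \<le> t\<^sup>2 / (2 * c)" using c by simp
    ultimately show ?thesis using norm_diff_clip[of c "X w"] c by (simp add: t_def)
  qed
  \<comment> \<open>As \<open>X\<close> has mean \<open>f\<close>, the bias of the clipped value is
    the expectation of what clipping removes.\<close>
  have "expectation W = expectation (\<lambda>w. X w - clip (X w) c)"
  proof -
    have *: "integrable M (\<lambda>w. f - X w)" using X by auto
    have "expectation (\<lambda>w. W w - (f - X w)) = expectation W"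
      using int_W * X by (simp add: prob_space)
    then show ?thesis by (simp add: W_def)
  qed
  then have "norm (expectation W) \<le> expectation (\<lambda>w. norm (X w - clip (X w) c))"
    by simp
  also have "\<dots> \<le> expectation (\<lambda>w. (norm (X w - f))\<^sup>2 / (2 * c))"
    using tail by (intro integral_mono' ) (auto intro!: divide_nonneg_nonneg simp: var c less_imp_le)
  also have "\<dots> \<le> s / (2 * c)" using var(2) c by (simp add: divide_right_mono)
  finally have bias: "norm (expectation W) \<le> s / (2 * c)" .
  have EW2: "expectation (\<lambda>w. (norm (W w))\<^sup>2) \<le> s"
    using integral_mono[OF int_W2 var(1) W_X2] var(2) by linarith
  have Ev: "expectation W \<bullet> v \<le> s / (2 * c) * V"
    using norm_cauchy_schwarz[of "expectation W" v] mult_mono[OF bias v] s c by fastforce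
  have "expectation Z = 2 * \<gamma> * (expectation W \<bullet> v) + \<gamma>\<^sup>2 * expectation (\<lambda>w. (norm (W w))\<^sup>2)"
    unfolding Z_def using int_W int_W2 by simp
  also have "\<dots> \<le> 2 * \<gamma> * (s / (2 * c) * V) + \<gamma>\<^sup>2 * s"
    using \<gamma> Ev EW2 by (intro add_mono mult_left_mono) auto
  finally have EZ: "expectation Z \<le> \<gamma> * V * s / c + \<gamma>\<^sup>2 * s"
    by (simp add: mult_ac)
  have EZ2: "expectation (\<lambda>w. (Z w)\<^sup>2) \<le> \<gamma>\<^sup>2 * s * (2 * V + 3 / 2 * \<gamma> * c)\<^sup>2"
  proof -
    have "expectation (\<lambda>w. (Z w)\<^sup>2) \<le> \<gamma>\<^sup>2 * (2 * V + 3 / 2 * \<gamma> * c)\<^sup>2 * expectation (\<lambda>w. (norm (X w - f))\<^sup>2)"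
      using integral_mono[OF int_Z2 _ Z2] var(1) by simp
    also have "\<dots> \<le> \<gamma>\<^sup>2 * (2 * V + 3 / 2 * \<gamma> * c)\<^sup>2 * s" by (intro mult_left_mono var) auto
    finally show ?thesis by (simp add: mult_ac)
  qed
  have int_q: "integrable M (\<lambda>w. 1 + \<theta> * Z w + \<theta>\<^sup>2 * (Z w)\<^sup>2)" using int_Z int_Z2 by simp
  have pw: "exp (\<theta> * Z w) \<le> 1 + \<theta> * Z w + \<theta>\<^sup>2 * (Z w)\<^sup>2" for w
    using exp_le_quadratic[of "\<theta> * Z w"] Z_bound[of w] \<theta>
    by (simp add: abs_mult power_mult_distrib)
  have "(\<integral>\<^sup>+w. ennreal (exp (\<theta> * Z w)) \<partial>M) \<le> (\<integral>\<^sup>+w. ennreal (1 + \<theta> * Z w + \<theta>\<^sup>2 * (Z w)\<^sup>2) \<partial>M)"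
    by (intro nn_integral_mono ennreal_leI pw)
  also have "\<dots> = ennreal (expectation (\<lambda>w. 1 + \<theta> * Z w + \<theta>\<^sup>2 * (Z w)\<^sup>2))"
    using pw by (intro nn_integral_eq_integral int_q) (meson AE_I2 exp_ge_zero order_trans)
  also have "expectation (\<lambda>w. 1 + \<theta> * Z w + \<theta>\<^sup>2 * (Z w)\<^sup>2)
      = 1 + (\<theta> * expectation Z + \<theta>\<^sup>2 * expectation (\<lambda>w. (Z w)\<^sup>2))"
    using int_Z int_Z2 by (simp add: prob_space)
  also have "\<dots> \<le> exp (\<theta> * expectation Z + \<theta>\<^sup>2 * expectation (\<lambda>w. (Z w)\<^sup>2))"
    by (rule exp_ge_add_one_self)
  also have "\<dots> \<le> exp (\<theta> * (\<gamma> * V * s / c + \<gamma>\<^sup>2 * s) + \<theta>\<^sup>2 * (\<gamma>\<^sup>2 * s * (2 * V + 3 / 2 * \<gamma> * c)\<^sup>2))"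
    using EZ EZ2 \<theta> by (auto intro!: add_mono mult_left_mono)
  finally show ?thesis by (simp add: Z_def ennreal_leI)
qed

section \<open>Independence: conditioning, variance of a mean, chains driven by independent
  inputs\<close>

text \<open>The joint law is a product, so Tonelli applies. The inner integral plays the role of the
  conditional expectation given \<open>X\<close>, with \<open>w'\<close> as an independent copy of
  the randomness.\<close>

lemma (in prob_space) nn_integral_indep_var:
  assumes ind: "indep_var S X T Y" and f[measurable]: "f \<in> borel_measurable (S \<Otimes>\<^sub>M T)"
  shows "(\<integral>\<^sup>+w. f (X w, Y w) \<partial>M) = (\<integral>\<^sup>+w. (\<integral>\<^sup>+w'. f (X w, Y w') \<partial>M) \<partial>M)"
proof -
  have [measurable]: "X \<in> M \<rightarrow>\<^sub>M S" "Y \<in> M \<rightarrow>\<^sub>M T"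
    using ind indep_var_rv1 indep_var_rv2 by blast+
  interpret X: prob_space "distr M S X" by (rule prob_space_distr) simp
  interpret Y: prob_space "distr M T Y" by (rule prob_space_distr) simp
  have "(\<integral>\<^sup>+w. f (X w, Y w) \<partial>M) = (\<integral>\<^sup>+z. f z \<partial>distr M (S \<Otimes>\<^sub>M T) (\<lambda>x. (X x, Y x)))"
    by (simp add: nn_integral_distr)
  also have "\<dots> = (\<integral>\<^sup>+z. f z \<partial>(distr M S X \<Otimes>\<^sub>M distr M T Y))"
    using ind by (simp add: indep_var_distribution_eq)
  also have "\<dots> = (\<integral>\<^sup>+x. (\<integral>\<^sup>+y. f (x, y) \<partial>distr M T Y) \<partial>distr M S X)"
    by (subst Y.nn_integral_fst[symmetric]) auto
  also have "\<dots> = (\<integral>\<^sup>+w. (\<integral>\<^sup>+w'. f (X w, Y w') \<partial>M) \<partial>M)"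
  proof -
    have "(\<integral>\<^sup>+y. f (X w, y) \<partial>distr M T Y) = (\<integral>\<^sup>+w'. f (X w, Y w') \<partial>M)" if "w \<in> space M" for w
    proof -
      have "X w \<in> space S" using that by (rule measurable_space[OF \<open>X \<in> M \<rightarrow>\<^sub>M S\<close>])
      then have "(\<lambda>y. f (X w, y)) \<in> borel_measurable T" by measurable
      then show ?thesis by (simp add: nn_integral_distr)
    qed
    then show ?thesis by (simp add: nn_integral_distr cong: nn_integral_cong)
  qed
  finally show ?thesis .
qed

text \<open>The squared deviation of the mean is a double sum of inner products. Independence
  removes the off-diagonal terms; \<open>card I\<close> diagonal terms are divided by the square of
  \<open>card I\<close>.\<close>

lemma (in prob_space)
  fixes U :: "'i \<Rightarrow> 'a \<Rightarrow> 'v::euclidean_space"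
  assumes I: "finite I" "I \<noteq> {}"
    and ind: "indep_vars (\<lambda>_. borel) U I"
    and U: "\<And>i. i \<in> I \<Longrightarrow> integrable M (U i)" "\<And>i. i \<in> I \<Longrightarrow> expectation (U i) = f"
    and var: "\<And>i. i \<in> I \<Longrightarrow> integrable M (\<lambda>w. (norm (U i w - f))\<^sup>2)"
      "\<And>i. i \<in> I \<Longrightarrow> expectation (\<lambda>w. (norm (U i w - f))\<^sup>2) \<le> s"
  defines "X \<equiv> \<lambda>w. (1 / real (card I)) *\<^sub>R (\<Sum>i\<in>I. U i w)"
  shows integrable_indep_mean: "integrable M X"
    and expectation_indep_mean: "expectation X = f"
    and integrable_variance_indep_mean: "integrable M (\<lambda>w. (norm (X w - f))\<^sup>2)"
    and variance_indep_mean: "expectation (\<lambda>w. (norm (X w - f))\<^sup>2) \<le> s / card I"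
proof -
  define n where "n = real (card I)"
  have n: "n > 0" using I by (simp add: n_def card_gt_0_iff)
  show "integrable M X" unfolding X_def using U by auto
  show "expectation X = f"
    unfolding X_def using U n by (simp add: n_def sum_constant_scaleR)
  define G where "G = (\<lambda>i w. U i w - f)"
  have G_ind: "indep_vars (\<lambda>_. borel) G I"
    unfolding G_def by (rule indep_vars_compose2[OF ind]) measurable
  have G: "integrable M (G i)" "expectation (G i) = 0" if "i \<in> I" for i
    using U that by (auto simp: G_def prob_space)
  have cross: "integrable M (\<lambda>w. G i w \<bullet> G j w) \<and> expectation (\<lambda>w. G i w \<bullet> G j w) = 0"
    if ij: "i \<in> I" "j \<in> I" "i \<noteq> j" for i j
  proof -
    \<comment> \<open>Expectations factor for real-valued products, so the inner product is treated
      coordinate by coordinate.\<close>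
    have c: "integrable M (\<lambda>w. (G i w \<bullet> b) * (G j w \<bullet> b)) \<and>
        expectation (\<lambda>w. (G i w \<bullet> b) * (G j w \<bullet> b)) = 0" for b
    proof -
      have "indep_var (PiM {i} (\<lambda>_. borel)) (\<lambda>w. restrict (\<lambda>i. G i w) {i})
          (PiM {j} (\<lambda>_. borel)) (\<lambda>w. restrict (\<lambda>i. G i w) {j})"
        using ij by (intro indep_var_restrict[OF G_ind]) auto
      then have "indep_var borel ((\<lambda>h. h i \<bullet> b) \<circ> (\<lambda>w. restrict (\<lambda>i. G i w) {i}))
          borel ((\<lambda>h. h j \<bullet> b) \<circ> (\<lambda>w. restrict (\<lambda>i. G i w) {j}))"
        by (rule indep_var_compose) measurable
      then have ind': "indep_var borel (\<lambda>w. G i w \<bullet> b) borel (\<lambda>w. G j w \<bullet> b)"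
        by (simp add: comp_def)
      have "integrable M (\<lambda>w. G i w \<bullet> b)" "integrable M (\<lambda>w. G j w \<bullet> b)"
        "expectation (\<lambda>w. G i w \<bullet> b) = 0"
        using G[OF ij(1)] G[OF ij(2)] by simp_all
      then show ?thesis
        using indep_var_lebesgue_integral[OF ind'] indep_var_integrable[OF ind'] by simp
    qed
    have eq: "G i w \<bullet> G j w = (\<Sum>b\<in>Basis. (G i w \<bullet> b) * (G j w \<bullet> b))" for w
      by (rule euclidean_inner)
    show ?thesis unfolding eq using c by simp
  qed
  have diag: "integrable M (\<lambda>w. G i w \<bullet> G i w)" "expectation (\<lambda>w. G i w \<bullet> G i w) \<le> s"
    if "i \<in> I" for i
    using var[OF that] by (simp_all add: G_def power2_norm_eq_inner)
  have int: "integrable M (\<lambda>w. G i w \<bullet> G j w)" if "i \<in> I" "j \<in> I" for i j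
    using that cross diag by (cases "i = j") auto
  have XG: "X w - f = (1 / n) *\<^sub>R (\<Sum>i\<in>I. G i w)" for w
    using n I by (simp add: X_def G_def sum_subtractf algebra_simps sum_constant_scaleR flip: n_def)
  have X2: "(norm (X w - f))\<^sup>2 = (\<Sum>i\<in>I. \<Sum>j\<in>I. G i w \<bullet> G j w) / n\<^sup>2" for w
    unfolding XG power2_norm_eq_inner
    by (simp add: inner_sum_left inner_sum_right inner_commute power2_eq_square
        sum_divide_distrib)
  show "integrable M (\<lambda>w. (norm (X w - f))\<^sup>2)"
    unfolding X2 using int by auto
  have "expectation (\<lambda>w. (norm (X w - f))\<^sup>2)
      = (\<Sum>i\<in>I. \<Sum>j\<in>I. expectation (\<lambda>w. G i w \<bullet> G j w)) / n\<^sup>2"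
    unfolding X2 using int by (simp add: integral_sum)
  also have "(\<Sum>i\<in>I. \<Sum>j\<in>I. expectation (\<lambda>w. G i w \<bullet> G j w))
      = (\<Sum>i\<in>I. expectation (\<lambda>w. G i w \<bullet> G i w))"
  proof (intro sum.cong refl)
    fix i assume i: "i \<in> I"
    have "(\<Sum>j\<in>I. expectation (\<lambda>w. G i w \<bullet> G j w))
        = (\<Sum>j\<in>I. if j = i then expectation (\<lambda>w. G i w \<bullet> G i w) else 0)"
      using i cross by (intro sum.cong) auto
    then show "(\<Sum>j\<in>I. expectation (\<lambda>w. G i w \<bullet> G j w)) = expectation (\<lambda>w. G i w \<bullet> G i w)"
      using i I by simp
  qed
  also have "\<dots> \<le> n * s" using sum_bounded_above[of I "\<lambda>i. expectation (\<lambda>w. G i w \<bullet> G i w)" s] diag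
    by (simp add: n_def)
  finally show "expectation (\<lambda>w. (norm (X w - f))\<^sup>2) \<le> s / card I"
    using n by (simp add: divide_right_mono power2_eq_square flip: n_def)
qed

text \<open>A supermartingale inequality without filtrations: \<open>s k\<close> depends only on the
  inputs before \<open>k\<close>, hence is independent of \<open>B k\<close>, and a bound valid for
  every fixed state \<open>x\<close> can be integrated over the law of \<open>s k\<close>.\<close>

lemma (in prob_space)
  fixes s :: "nat \<Rightarrow> 'a \<Rightarrow> 's"
  assumes ind: "indep_vars N B UNIV"
    and step: "\<And>k. (\<lambda>(x, b). step k x b) \<in> S \<Otimes>\<^sub>M N k \<rightarrow>\<^sub>M S"
    and s_0: "\<And>w. s 0 w = c" and c: "c \<in> space S"
    and s_Suc: "\<And>k w. s (Suc k) w = step k (s k w) (B k w)"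
  shows measurable_chain: "s n \<in> M \<rightarrow>\<^sub>M S"
    and nn_integral_chain_le:
      "(\<And>k. \<Phi> k \<in> borel_measurable S) \<Longrightarrow>
       (\<And>k x. k < n \<Longrightarrow> x \<in> space S \<Longrightarrow> (\<integral>\<^sup>+w. \<Phi> (Suc k) (step k x (B k w)) \<partial>M) \<le> \<Phi> k x) \<Longrightarrow>
       (\<integral>\<^sup>+w. \<Phi> n (s n w) \<partial>M) \<le> \<Phi> 0 c"
proof -
  \<comment> \<open>\<open>H k h\<close> recomputes the state from a sequence of inputs, reading
    only \<open>h 0\<close> up to \<open>h (k - 1)\<close>; this exhibits \<open>s k\<close> as a
    function of the past.\<close>
  define H where "H = rec_nat (\<lambda>h. c) (\<lambda>k g h. step k (g h) (h k))"
  have H_0: "H 0 h = c" and H_Suc: "H (Suc k) h = step k (H k h) (h k)" for k h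
    by (auto simp: H_def)
  have H_meas: "H k \<in> PiM {..<n} N \<rightarrow>\<^sub>M S" if "k \<le> n" for k n
    using that
  proof (induction k)
    case 0
    then show ?case using c by (simp add: H_0[abs_def])
  next
    case (Suc k)
    then have [measurable]: "H k \<in> PiM {..<n} N \<rightarrow>\<^sub>M S" "(\<lambda>h. h k) \<in> PiM {..<n} N \<rightarrow>\<^sub>M N k"
      by auto
    note step[measurable]
    have "(\<lambda>h. (\<lambda>(x, b). step k x b) (H k h, h k)) \<in> PiM {..<n} N \<rightarrow>\<^sub>M S" by measurable
    then show ?case by (simp add: H_Suc[abs_def])
  qed
  have s_H: "s k w = H k (restrict (\<lambda>i. B i w) {..<n})" if "k \<le> n" for k n w
    using that by (induction k) (auto simp: H_0 H_Suc s_0 s_Suc)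
  have B: "B k \<in> M \<rightarrow>\<^sub>M N k" for k using ind by (auto simp: indep_vars_def)
  show s_meas: "s n \<in> M \<rightarrow>\<^sub>M S" for n
    unfolding s_H[OF order_refl, abs_def]
    by (rule measurable_compose[OF measurable_restrict H_meas]) (auto intro: B)
  assume \<Phi>[measurable]: "\<And>k. \<Phi> k \<in> borel_measurable S"
    and dec: "\<And>k x. k < n \<Longrightarrow> x \<in> space S \<Longrightarrow> (\<integral>\<^sup>+w. \<Phi> (Suc k) (step k x (B k w)) \<partial>M) \<le> \<Phi> k x"
  have "k \<le> n \<Longrightarrow> (\<integral>\<^sup>+w. \<Phi> k (s k w) \<partial>M) \<le> \<Phi> 0 c" for k
  proof (induction k)
    case 0
    then show ?case by (simp add: s_0 emeasure_space_1)
  next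
    case (Suc k)
    \<comment> \<open>Past and present are restrictions of one independent family to disjoint index
      sets; the single input \<open>B k\<close> is therefore packed as a function on
      \<open>{k}\<close>.\<close>
    have "indep_var (PiM {..<k} N) (\<lambda>w. restrict (\<lambda>i. B i w) {..<k})
        (PiM {k} N) (\<lambda>w. restrict (\<lambda>i. B i w) {k})"
      by (intro indep_var_restrict[OF ind]) auto
    moreover have "(\<lambda>p. (H k (fst p), snd p k)) \<in> PiM {..<k} N \<Otimes>\<^sub>M PiM {k} N \<rightarrow>\<^sub>M S \<Otimes>\<^sub>M N k"
      using measurable_compose[OF measurable_fst H_meas[OF order_refl]]
        measurable_compose[OF measurable_snd measurable_component_singleton[of k "{k}" N]]
      by (intro measurable_Pair) auto
    from measurable_compose[OF measurable_compose[OF this step] \<Phi>[of "Suc k"]]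
    have "(\<lambda>p. \<Phi> (Suc k) (step k (H k (fst p)) (snd p k)))
        \<in> borel_measurable (PiM {..<k} N \<Otimes>\<^sub>M PiM {k} N)"
      by simp
    ultimately have "(\<integral>\<^sup>+w. \<Phi> (Suc k) (step k (H k (restrict (\<lambda>i. B i w) {..<k})) (restrict (\<lambda>i. B i w) {k} k)) \<partial>M)
        = (\<integral>\<^sup>+w. (\<integral>\<^sup>+w'. \<Phi> (Suc k) (step k (H k (restrict (\<lambda>i. B i w) {..<k})) (restrict (\<lambda>i. B i w') {k} k)) \<partial>M) \<partial>M)"
      by (auto dest: nn_integral_indep_var)
    then have "(\<integral>\<^sup>+w. \<Phi> (Suc k) (s (Suc k) w) \<partial>M)
        = (\<integral>\<^sup>+w. (\<integral>\<^sup>+w'. \<Phi> (Suc k) (step k (s k w) (B k w')) \<partial>M) \<partial>M)"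
      by (simp add: s_Suc s_H[of k k])
    also have "\<dots> \<le> (\<integral>\<^sup>+w. \<Phi> k (s k w) \<partial>M)"
      using Suc.prems s_meas by (intro nn_integral_mono dec) (auto dest: measurable_space)
    finally show ?case using Suc by simp
  qed
  then show "(\<integral>\<^sup>+w. \<Phi> n (s n w) \<partial>M) \<le> \<Phi> 0 c" by simp
qed

text \<open>\<open>L\<close> stands for \<open>ln (6 * (K + 1) / \<beta>)\<close>, of which only
  \<open>1 \<le> L\<close> is recorded here; \<open>\<beta>\<close> returns in the final theorem
  through \<open>exp (- L)\<close>.\<close>

locale clipped_sgda_setting = prob_space M for M :: "'w measure" +
  fixes D :: "'b measure"
    and Fo :: "'b \<Rightarrow> 'a::euclidean_space \<Rightarrow> 'a"
    and F proj :: "'a \<Rightarrow> 'a"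
    and \<xi> :: "nat \<Rightarrow> nat \<Rightarrow> 'w \<Rightarrow> 'b"
    and x0 xstar :: 'a
    and R \<sigma> l \<gamma> L :: real
    and m0 K :: nat
  assumes prob_D: "prob_space D"
    and oracle_measurable: "(\<lambda>(z, x). Fo z x) \<in> borel_measurable (D \<Otimes>\<^sub>M borel)"
    and oracle_integrable: "integrable D (\<lambda>z. Fo z x)"
    and F_eq: "F x = (\<integral>z. Fo z x \<partial>D)"
    and samples_indep: "indep_vars (\<lambda>_. D) (\<lambda>(k, i). \<xi> i k) (UNIV \<times> {1..m0})"
    and samples_distr: "i \<in> {1..m0} \<Longrightarrow> distr M D (\<xi> i k) = D"
    and F_xstar: "F xstar = 0"
    and x0_xstar: "norm (x0 - xstar) \<le> R"
    and bounded_variance: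
      "norm (x - xstar) \<le> 2 * R \<Longrightarrow> integrable D (\<lambda>z. (norm (Fo z x - F x))\<^sup>2)"
      "norm (x - xstar) \<le> 2 * R \<Longrightarrow> (\<integral>z. (norm (Fo z x - F x))\<^sup>2 \<partial>D) \<le> \<sigma>\<^sup>2"
    and monotone: "norm (x - xstar) \<le> 2 * R \<Longrightarrow> norm (y - xstar) \<le> 2 * R \<Longrightarrow>
      0 \<le> (F x - F y) \<bullet> (x - y)"
    and proj: "norm (x - xstar) \<le> 2 * R \<Longrightarrow> is_projection (solution_set F) x (proj x)"
    and cocoercive: "norm (x - xstar) \<le> 2 * R \<Longrightarrow> (norm (F x))\<^sup>2 \<le> l * (F x \<bullet> (x - proj x))"
    and R: "0 < R" and l: "0 < l" and L: "1 \<le> L" and \<gamma>: "0 < \<gamma>"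
    and \<gamma>_le: "\<gamma> \<le> 1 / (170 * l * L)"
    and m0: "1 \<le> m0" "97200 * real (K + 1) * \<gamma>\<^sup>2 * \<sigma>\<^sup>2 * L / R\<^sup>2 \<le> real m0"
begin

sublocale D: prob_space D by (rule prob_D)

definition c :: real where "c = R / (60 * \<gamma> * L)"

text \<open>The keys are pairs \<open>(k, i)\<close>, so that batches are restrictions of one
  independent family to disjoint index sets.\<close>

definition batch :: "nat \<Rightarrow> 'w \<Rightarrow> nat \<times> nat \<Rightarrow> 'b" where
  "batch k w = restrict (\<lambda>p. (case p of (k, i) \<Rightarrow> \<xi> i k) w) ({k} \<times> {1..m0})"

definition mean :: "nat \<Rightarrow> 'a \<Rightarrow> (nat \<times> nat \<Rightarrow> 'b) \<Rightarrow> 'a" where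
  "mean k x b = (1 / real m0) *\<^sub>R (\<Sum>p\<in>{k} \<times> {1..m0}. Fo (b p) x)"

definition noise :: "nat \<Rightarrow> 'a \<Rightarrow> (nat \<times> nat \<Rightarrow> 'b) \<Rightarrow> 'a" where
  "noise k x b = F x - clip (mean k x b) c"

text \<open>The pair consists of the iterate and the accumulated noise \<open>y\<^sub>k\<close>. The
  radius \<open>5 / 4 * R\<close> is inside the ball of radius \<open>2 * R\<close> where the
  assumptions hold, and both radii exceed what the potentials allow, so leaving the region gives a
  contradiction.\<close>

definition good :: "'a \<times> 'a \<Rightarrow> bool" where
  "good p \<longleftrightarrow> norm (fst p - xstar) \<le> 5 / 4 * R \<and> norm (snd p) \<le> R"

definition step :: "nat \<Rightarrow> 'a \<times> 'a \<Rightarrow> (nat \<times> nat \<Rightarrow> 'b) \<Rightarrow> 'a \<times> 'a" where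
  "step k p b = (if good p
     then (fst p - \<gamma> *\<^sub>R clip (mean k (fst p) b) c, snd p + \<gamma> *\<^sub>R noise k (fst p) b) else p)"

primrec state :: "nat \<Rightarrow> 'w \<Rightarrow> 'a \<times> 'a" where
  "state 0 w = (x0, 0)"
| "state (Suc k) w = step k (state k w) (batch k w)"

text \<open>The part of a one-step change of a squared norm that is due to the noise,
  \<open>v\<close> being the direction that multiplies it. It vanishes once the process is frozen,
  so \<open>v\<close> has to be bounded at good states only.\<close>

definition incr :: "('a \<times> 'a \<Rightarrow> 'a) \<Rightarrow> nat \<Rightarrow> 'a \<times> 'a \<Rightarrow> (nat \<times> nat \<Rightarrow> 'b) \<Rightarrow> real" where
  "incr v k p b = (if good p
     then 2 * \<gamma> * (noise k (fst p) b \<bullet> v p) + \<gamma>\<^sup>2 * (norm (noise k (fst p) b))\<^sup>2 else 0)"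

definition acc :: "('a \<times> 'a \<Rightarrow> 'a) \<Rightarrow> nat \<Rightarrow> 'w \<Rightarrow> real" where
  "acc v n w = (\<Sum>k<n. incr v k (state k w) (batch k w))"

section \<open>Size of the operator in the good region\<close>

lemma c_pos: "0 < c" and \<gamma>c: "\<gamma> * c = R / (60 * L)"
  using R L \<gamma> by (auto simp: c_def)

lemma \<gamma>l: "\<gamma> * l \<le> 1 / (170 * L)" "\<gamma> * l \<le> 1 / 170"
proof -
  show "\<gamma> * l \<le> 1 / (170 * L)" using \<gamma>_le l L by (simp add: field_simps)
  also have "\<dots> \<le> 1 / 170" using L by (simp add: field_simps)
  finally show "\<gamma> * l \<le> 1 / 170" .
qed

text \<open>\<open>xstar\<close> is itself a solution, hence no closer to \<open>x\<close> than
  \<open>proj x\<close>; Cauchy-Schwarz in the star-cocoercivity bound then gives linear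
  growth.\<close>

lemma norm_F_le:
  assumes "norm (x - xstar) \<le> 2 * R"
  shows "norm (F x) \<le> l * norm (x - xstar)"
proof -
  have "norm (x - proj x) \<le> norm (x - xstar)"
    using proj[OF assms] F_xstar by (auto simp: is_projection_def solution_set_def dist_norm)
  then have "l * (F x \<bullet> (x - proj x)) \<le> l * (norm (F x) * norm (x - xstar))"
    using norm_cauchy_schwarz[of "F x" "x - proj x"] l
    by (intro mult_left_mono) (meson mult_left_mono norm_ge_zero order_trans, simp)
  then have "norm (F x) * norm (F x) \<le> norm (F x) * (l * norm (x - xstar))"
    using cocoercive[OF assms] by (simp add: power2_eq_square mult_ac)
  then show ?thesis using l by (cases "F x = 0") auto
qed

text \<open>\<open>5 / (4 * 170) = 1 / 136\<close> is below \<open>1 / 120\<close>, half of the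
  \<open>1 / 60\<close> in the clipping level. So the operator stays below \<open>c / 2\<close>, as
  \<open>clip_exp_moment\<close> requires.\<close>

lemma good_D:
  assumes "good p"
  shows "norm (fst p - xstar) \<le> 2 * R" "norm (F (fst p)) \<le> c / 2" "\<gamma> * norm (F (fst p)) \<le> R / 100"
proof -
  show *: "norm (fst p - xstar) \<le> 2 * R" using assms R by (simp add: good_def)
  have "norm (F (fst p)) \<le> l * (5 / 4 * R)"
    using norm_F_le[OF *] assms l by (smt (verit) good_def mult_left_mono)
  then have "\<gamma> * norm (F (fst p)) \<le> \<gamma> * (l * (5 / 4 * R))"
    using \<gamma> by (intro mult_left_mono) auto
  also have "\<dots> = (\<gamma> * l) * (5 / 4 * R)" by simp
  finally have **: "\<gamma> * norm (F (fst p)) \<le> (\<gamma> * l) * (5 / 4 * R)" .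
  also have "\<dots> \<le> 1 / 170 * (5 / 4 * R)" using R \<gamma>l by (intro mult_right_mono) auto
  also have "\<dots> \<le> R / 100" using R by simp
  finally show "\<gamma> * norm (F (fst p)) \<le> R / 100" .
  note **
  also have "(\<gamma> * l) * (5 / 4 * R) \<le> 1 / (170 * L) * (5 / 4 * R)"
    using R \<gamma>l by (intro mult_right_mono) auto
  also have "\<dots> \<le> \<gamma> * (c / 2)" using \<gamma>c R L by (simp add: field_simps)
  finally show "norm (F (fst p)) \<le> c / 2" using \<gamma> by simp
qed

section \<open>Measurability of the process and independence of the batches\<close>

lemma F_measurable [measurable]: "F \<in> borel_measurable borel"
proof -
  have "(\<lambda>p. (\<lambda>(z, x). Fo z x) (snd p, fst p)) \<in> borel_measurable (borel \<Otimes>\<^sub>M D)"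
    using oracle_measurable by measurable
  then have "(\<lambda>x. \<integral>z. Fo z x \<partial>D) \<in> borel_measurable borel"
    by (intro D.borel_measurable_lebesgue_integral) (simp add: case_prod_beta')
  then show ?thesis by (simp add: F_eq[abs_def])
qed

abbreviation N :: "nat \<Rightarrow> (nat \<times> nat \<Rightarrow> 'b) measure" where
  "N k \<equiv> PiM ({k} \<times> {1..m0}) (\<lambda>_. D)"

lemma \<xi>_measurable: "i \<in> {1..m0} \<Longrightarrow> \<xi> i k \<in> M \<rightarrow>\<^sub>M D"
  using samples_indep by (auto simp: indep_vars_def)

lemma batch_indep: "indep_vars N batch UNIV"
  unfolding batch_def
  by (rule indep_vars_restrict[OF samples_indep]) (auto simp: disjoint_family_on_def)

lemma batch_measurable [measurable]: "batch k \<in> M \<rightarrow>\<^sub>M N k"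
  using batch_indep by (auto simp: indep_vars_def)

lemma mean_measurable [measurable]:
  "(\<lambda>(x, b). mean k x b) \<in> borel_measurable (borel \<Otimes>\<^sub>M N k)"
proof -
  have "(\<lambda>q. (\<lambda>(z, x). Fo z x) (snd q p, fst q)) \<in> borel_measurable (borel \<Otimes>\<^sub>M N k)"
    if "p \<in> {k} \<times> {1..m0}" for p
    using that oracle_measurable by measurable
  then show ?thesis unfolding mean_def case_prod_beta' by (auto intro!: borel_measurable_sum)
qed

lemma noise_measurable [measurable]:
  "(\<lambda>(x, b). noise k x b) \<in> borel_measurable (borel \<Otimes>\<^sub>M N k)"
  unfolding noise_def by measurable

lemma good_measurable [measurable]: "Measurable.pred (borel \<Otimes>\<^sub>M borel) good"
  unfolding good_def by measurable

lemma step_measurable [measurable]: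
  "(\<lambda>(p, b). step k p b) \<in> (borel \<Otimes>\<^sub>M borel) \<Otimes>\<^sub>M N k \<rightarrow>\<^sub>M borel \<Otimes>\<^sub>M borel"
  unfolding step_def by measurable

lemma incr_measurable [measurable]:
  assumes [measurable]: "v \<in> borel_measurable (borel \<Otimes>\<^sub>M borel)"
  shows "(\<lambda>(p, b). incr v k p b) \<in> borel_measurable ((borel \<Otimes>\<^sub>M borel) \<Otimes>\<^sub>M N k)"
  unfolding incr_def by measurable

lemma state_measurable [measurable]: "state n \<in> M \<rightarrow>\<^sub>M borel \<Otimes>\<^sub>M borel"
  by (rule measurable_chain[where c="(x0, 0)", OF batch_indep step_measurable])
    (auto simp: space_pair_measure)

lemma acc_measurable [measurable]:
  assumes v[measurable]: "v \<in> borel_measurable (borel \<Otimes>\<^sub>M borel)"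
  shows "acc v n \<in> borel_measurable M"
proof -
  have "(\<lambda>w. (\<lambda>(p, b). incr v k p b) (state k w, batch k w)) \<in> borel_measurable M" for k
    by (rule measurable_compose[OF measurable_Pair incr_measurable[OF v]])
      (rule state_measurable, rule batch_measurable)
  then show ?thesis unfolding acc_def[abs_def] by (auto intro!: borel_measurable_sum)
qed

section \<open>Exponential moments and tails of the accumulated noise\<close>

text \<open>The upper bound on \<open>\<sigma>\<^sup>2 / m0\<close> that the batchsize condition
  guarantees.\<close>

definition mean_var :: real where "mean_var = R\<^sup>2 / (97200 * real (K + 1) * \<gamma>\<^sup>2 * L)"

lemma
  assumes x: "norm (x - xstar) \<le> 2 * R"
  shows mean_integrable: "integrable M (\<lambda>w. mean k x (batch k w))"
    and mean_expectation: "expectation (\<lambda>w. mean k x (batch k w)) = F x"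
    and mean_variance_integrable: "integrable M (\<lambda>w. (norm (mean k x (batch k w) - F x))\<^sup>2)"
    and mean_variance: "expectation (\<lambda>w. (norm (mean k x (batch k w) - F x))\<^sup>2) \<le> mean_var"
proof -
  let ?I = "{k} \<times> {1..m0}"
  let ?U = "\<lambda>p w. Fo ((case p of (k, i) \<Rightarrow> \<xi> i k) w) x"
  have eq: "mean k x (batch k w) = (1 / real (card ?I)) *\<^sub>R (\<Sum>p\<in>?I. ?U p w)" for w
    by (simp add: mean_def batch_def card_cartesian_product)
  have I: "finite ?I" "?I \<noteq> {}" using m0 by auto
  have "(\<lambda>z. (\<lambda>(z, x). Fo z x) (z, x)) \<in> borel_measurable D"
    using oracle_measurable by measurable
  then have Fo[measurable]: "(\<lambda>z. Fo z x) \<in> borel_measurable D" by simp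
  have ind: "indep_vars (\<lambda>_. borel) ?U ?I"
    by (rule indep_vars_compose2[OF indep_vars_subset[OF samples_indep]]) auto
  have distr: "integrable D f \<Longrightarrow> integrable M (\<lambda>w. f (\<xi> i k w))"
    "f \<in> borel_measurable D \<Longrightarrow> expectation (\<lambda>w. f (\<xi> i k w)) = (\<integral>z. f z \<partial>D)"
    if "i \<in> {1..m0}" for i and f :: "'b \<Rightarrow> 'x::{banach, second_countable_topology}"
    using samples_distr[OF that, of k] \<xi>_measurable[OF that, of k]
      integrable_distr[of "\<xi> i k" M D f] integral_distr[of "\<xi> i k" M D f] by auto
  have U: "integrable M (?U p)" "expectation (?U p) = F x"
     "integrable M (\<lambda>w. (norm (?U p w - F x))\<^sup>2)" "expectation (\<lambda>w. (norm (?U p w - F x))\<^sup>2) \<le> \<sigma>\<^sup>2"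
    if "p \<in> ?I" for p
    using that distr(1)[OF _ oracle_integrable] distr(2)[OF _ Fo] F_eq
     distr(1)[OF _ bounded_variance(1)[OF x]] distr(2)[of _ "\<lambda>z. (norm (Fo z x - F x))\<^sup>2"]
     bounded_variance(2)[OF x] by auto
  note * = I ind U
  show "integrable M (\<lambda>w. mean k x (batch k w))"
    unfolding eq by (rule integrable_indep_mean[OF *])
  show "expectation (\<lambda>w. mean k x (batch k w)) = F x"
    unfolding eq by (rule expectation_indep_mean[OF *])
  show "integrable M (\<lambda>w. (norm (mean k x (batch k w) - F x))\<^sup>2)"
    unfolding eq by (rule integrable_variance_indep_mean[OF *])
  have "expectation (\<lambda>w. (norm (mean k x (batch k w) - F x))\<^sup>2) \<le> \<sigma>\<^sup>2 / real (card ?I)"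
    unfolding eq by (rule variance_indep_mean[OF *])
  also have "\<dots> \<le> mean_var"
  proof -
    define A where "A = 97200 * real (K + 1) * \<gamma>\<^sup>2 * L"
    have A: "A > 0" using \<gamma> L by (simp add: A_def)
    have "A * \<sigma>\<^sup>2 / R\<^sup>2 \<le> real m0" using m0(2) by (simp add: A_def mult_ac)
    then have "\<sigma>\<^sup>2 * A \<le> R\<^sup>2 * real m0" using R by (simp add: field_simps)
    then have "\<sigma>\<^sup>2 / real m0 \<le> R\<^sup>2 / A" using A m0(1) by (simp add: divide_simps mult.commute)
    then show ?thesis by (simp add: card_cartesian_product mean_var_def A_def)
  qed
  finally show "expectation (\<lambda>w. (norm (mean k x (batch k w) - F x))\<^sup>2) \<le> mean_var" .
qed

text \<open>Small enough for \<open>\<bar>\<theta> * incr v k p b\<bar> \<le> 1\<close>, and with \<open>\<theta> * R\<^sup>2 / 10 = 6 / 5 * L\<close>, which leaves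
  \<open>L / 5\<close> for the drift.\<close>
definition \<theta> :: real where "\<theta> = 12 * L / R\<^sup>2"

text \<open>This is \<open>clip_exp_moment\<close> with \<open>V = 3 / 2 * R\<close>. The cost per
  step is such that \<open>K + 1\<close> steps together cost the factor
  \<open>exp (L / 40)\<close>.\<close>

lemma incr_exp_moment:
  assumes v: "good p \<Longrightarrow> norm (v p) \<le> 3 / 2 * R"
  shows "(\<integral>\<^sup>+w. ennreal (exp (\<theta> * incr v k p (batch k w))) \<partial>M)
    \<le> ennreal (exp (L / (40 * real (K + 1))))"
proof (cases "good p")
  case False
  then show ?thesis using L by (simp add: incr_def emeasure_space_1)
next
  case True
  have \<theta>: "0 < \<theta>" using R L by (simp add: \<theta>_def)
  have s_eq: "\<gamma>\<^sup>2 * mean_var = R\<^sup>2 / (97200 * real (K + 1) * L)" using \<gamma> by (simp add: mean_var_def)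
  \<comment> \<open>The factor \<open>1 / L\<close> in \<open>\<gamma> * c\<close> cancels the
    \<open>L\<close> in \<open>\<theta>\<close>, leaving a bound that is uniform in
    \<open>L\<close>.\<close>
  have small: "\<theta> * (3 * \<gamma> * c * (3 / 2 * R) + (3 / 2 * \<gamma> * c)\<^sup>2) \<le> 1"
  proof -
    have "3 * \<gamma> * c * (3 / 2 * R) + (3 / 2 * \<gamma> * c)\<^sup>2
        = 9 / 2 * R * (\<gamma> * c) + 9 / 4 * (\<gamma> * c)\<^sup>2"
      by (simp add: power_mult_distrib power2_eq_square mult_ac)
    also have "\<theta> * \<dots> = 9 / 10 + 3 / (400 * L)"
      unfolding \<gamma>c \<theta>_def using R L by (simp add: field_simps power2_eq_square)
    also have "\<dots> \<le> 1" using L by (simp add: field_simps)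
    finally show ?thesis .
  qed
  have "\<theta> * (\<gamma> * (3 / 2 * R) * mean_var / c + \<gamma>\<^sup>2 * mean_var) + \<theta>\<^sup>2 * (\<gamma>\<^sup>2 * mean_var * (2 * (3 / 2 * R) + 3 / 2 * \<gamma> * c)\<^sup>2)
      = \<theta> * (\<gamma>\<^sup>2 * mean_var) * ((3 / 2 * R / (\<gamma> * c) + 1) + \<theta> * (3 * R + 3 / 2 * (\<gamma> * c))\<^sup>2)"
    using \<gamma> c_pos by (simp add: field_simps power2_eq_square)
  also have "(3 / 2 * R / (\<gamma> * c) + 1) + \<theta> * (3 * R + 3 / 2 * (\<gamma> * c))\<^sup>2
      = 90 * L + 1 + 12 * L * (3 + 1 / (40 * L))\<^sup>2"
    unfolding \<gamma>c \<theta>_def using R L by (simp add: field_simps power2_eq_square)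
  also have "\<theta> * (\<gamma>\<^sup>2 * mean_var) * (90 * L + 1 + 12 * L * (3 + 1 / (40 * L))\<^sup>2)
      \<le> \<theta> * (\<gamma>\<^sup>2 * mean_var) * (405 / 2 * L)"
  proof (intro mult_left_mono)
    have "(3 + 1 / (40 * L))\<^sup>2 \<le> (3 + 1 / 40)\<^sup>2"
      using L by (intro power_mono add_left_mono) (auto simp: field_simps)
    then have "12 * L * (3 + 1 / (40 * L))\<^sup>2 \<le> 12 * L * (3 + 1 / 40)\<^sup>2"
      using L by (intro mult_left_mono) auto
    also have "\<dots> \<le> 111 * L" using L by (simp add: power2_eq_square)
    finally show "90 * L + 1 + 12 * L * (3 + 1 / (40 * L))\<^sup>2 \<le> 405 / 2 * L" using L by linarith
    show "0 \<le> \<theta> * (\<gamma>\<^sup>2 * mean_var)" unfolding s_eq using \<theta> L R by simp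
  qed
  \<comment> \<open>The origin of the batchsize constant:
    \<open>97200 = 40 * 12 * (405 / 2)\<close>, with \<open>12\<close> from \<open>\<theta>\<close>
    and \<open>405 / 2\<close> from rounding up \<open>90 + 1 + 111\<close>.\<close>
  also have "\<dots> = L / (40 * real (K + 1))"
  proof -
    have *: "12 * L / R\<^sup>2 * (R\<^sup>2 / (97200 * B * L)) * (405 / 2 * L) = L / (40 * B)" if "0 < B" for B
      using R L that by (simp add: field_simps)
    show ?thesis unfolding s_eq \<theta>_def by (rule *) simp
  qed
  finally have bound: "\<theta> * (\<gamma> * (3 / 2 * R) * mean_var / c + \<gamma>\<^sup>2 * mean_var)
      + \<theta>\<^sup>2 * (\<gamma>\<^sup>2 * mean_var * (2 * (3 / 2 * R) + 3 / 2 * \<gamma> * c)\<^sup>2) \<le> L / (40 * real (K + 1))" .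
  note x = good_D[OF True]
  have "(\<integral>\<^sup>+w. ennreal (exp (\<theta> * incr v k p (batch k w))) \<partial>M)
    \<le> ennreal (exp (\<theta> * (\<gamma> * (3 / 2 * R) * mean_var / c + \<gamma>\<^sup>2 * mean_var)
      + \<theta>\<^sup>2 * (\<gamma>\<^sup>2 * mean_var * (2 * (3 / 2 * R) + 3 / 2 * \<gamma> * c)\<^sup>2)))"
    using clip_exp_moment[OF mean_integrable[OF x(1)] mean_expectation[OF x(1)]
      mean_variance_integrable[OF x(1)] mean_variance[OF x(1)] x(2) c_pos v[OF True] \<gamma> \<theta> small]
    using True by (simp add: incr_def noise_def)
  also have "\<dots> \<le> ennreal (exp (L / (40 * real (K + 1))))" using bound by (intro ennreal_leI) simp
  finally show ?thesis .
qed

text \<open>Markov's inequality for the exponential of \<open>\<theta> * acc\<close>. At the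
  threshold the exponent is \<open>6 / 5 * L\<close>; after subtracting the total drift
  \<open>L / 40\<close> at least \<open>L\<close> remains.\<close>

lemma acc_tail:
  assumes v_meas[measurable]: "v \<in> borel_measurable (borel \<Otimes>\<^sub>M borel)"
    and v: "\<And>p. good p \<Longrightarrow> norm (v p) \<le> 3 / 2 * R"
  shows "prob {w \<in> space M. R\<^sup>2 / 10 \<le> acc v (Suc K) w} \<le> exp (- L)"
proof -
  define t where "t = L / (40 * real (K + 1))"
  \<comment> \<open>The factor \<open>exp (- (k * t))\<close> compensates the growth by at most
    \<open>exp t\<close> per step. The accumulated sum is made part of the chain, since
    \<open>\<Phi>\<close> may look only at the current state.\<close>
  define \<Phi> where "\<Phi> = (\<lambda>(k::nat) (q::('a \<times> 'a) \<times> real). ennreal (exp (- (real k * t))) * ennreal (exp (\<theta> * snd q)))"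
  define st where "st = (\<lambda>k (q::('a \<times> 'a) \<times> real) b. (step k (fst q) b, snd q + incr v k (fst q) b))"
  have "(\<lambda>(q, b). st k q b) \<in> ((borel \<Otimes>\<^sub>M borel) \<Otimes>\<^sub>M borel) \<Otimes>\<^sub>M N k \<rightarrow>\<^sub>M (borel \<Otimes>\<^sub>M borel) \<Otimes>\<^sub>M borel" for k
    unfolding st_def by measurable
  note * = batch_indep this
  have \<theta>: "0 < \<theta>" using R L by (simp add: \<theta>_def)
  have "(\<integral>\<^sup>+w. \<Phi> (Suc K) (state (Suc K) w, acc v (Suc K) w) \<partial>M) \<le> \<Phi> 0 ((x0, 0), 0)"
  proof (rule nn_integral_chain_le[OF *, where s = "\<lambda>k w. (state k w, acc v k w)"])
    show "(state (Suc k) w, acc v (Suc k) w) = st k (state k w, acc v k w) (batch k w)" for k w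
      by (simp add: st_def acc_def)
    fix k
    show "\<Phi> k \<in> borel_measurable ((borel \<Otimes>\<^sub>M borel) \<Otimes>\<^sub>M borel)"
      unfolding \<Phi>_def by measurable
    fix q :: "('a \<times> 'a) \<times> real"
    define p a where "p = fst q" and "a = snd q"
    have "(\<lambda>w. (\<lambda>(p, b). incr v k p b) (p, batch k w)) \<in> borel_measurable M"
      by (rule measurable_compose[OF measurable_Pair incr_measurable[OF v_meas]])
        (simp add: space_pair_measure, rule batch_measurable)
    then have [measurable]: "(\<lambda>w. incr v k p (batch k w)) \<in> borel_measurable M" by simp
    have "\<Phi> (Suc k) (st k q b) = ennreal (exp (- (real (Suc k) * t)) * exp (\<theta> * a)) * ennreal (exp (\<theta> * incr v k p b))" for b
      unfolding \<Phi>_def st_def p_def a_def by (simp add: distrib_left exp_add mult.assoc flip: ennreal_mult)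
    then have "(\<integral>\<^sup>+w. \<Phi> (Suc k) (st k q (batch k w)) \<partial>M)
      = ennreal (exp (- (real (Suc k) * t)) * exp (\<theta> * a)) * (\<integral>\<^sup>+w. ennreal (exp (\<theta> * incr v k p (batch k w))) \<partial>M)"
      by (simp add: nn_integral_cmult)
    also have "\<dots> \<le> ennreal (exp (- (real (Suc k) * t)) * exp (\<theta> * a)) * ennreal (exp t)"
      unfolding t_def by (intro mult_left_mono incr_exp_moment v) auto
    also have "\<dots> = \<Phi> k q"
      by (simp add: \<Phi>_def a_def mult_ac distrib_left distrib_right flip: ennreal_mult exp_add)
    finally show "(\<integral>\<^sup>+w. \<Phi> (Suc k) (st k q (batch k w)) \<partial>M) \<le> \<Phi> k q" .
  qed (auto simp: acc_def space_pair_measure)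
  also have "\<Phi> 0 ((x0, 0), 0) = 1" by (simp add: \<Phi>_def)
  finally have le1: "(\<integral>\<^sup>+w. \<Phi> (Suc K) (state (Suc K) w, acc v (Suc K) w) \<partial>M) \<le> 1" .
  have t: "real (Suc K) * t = L / 40" by (simp add: t_def del: of_nat_Suc)
  have "ennreal (exp L) * emeasure M {w \<in> space M. R\<^sup>2 / 10 \<le> acc v (Suc K) w}
      = (\<integral>\<^sup>+w. ennreal (exp L) * indicator {w \<in> space M. R\<^sup>2 / 10 \<le> acc v (Suc K) w} w \<partial>M)"
    by (simp add: nn_integral_cmult_indicator)
  also have "\<dots> \<le> (\<integral>\<^sup>+w. \<Phi> (Suc K) (state (Suc K) w, acc v (Suc K) w) \<partial>M)"
  proof (intro nn_integral_mono)
    fix w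
    show "ennreal (exp L) * indicator {w \<in> space M. R\<^sup>2 / 10 \<le> acc v (Suc K) w} w
      \<le> \<Phi> (Suc K) (state (Suc K) w, acc v (Suc K) w)"
    proof (cases "R\<^sup>2 / 10 \<le> acc v (Suc K) w")
      case True
      have "\<theta> * (R\<^sup>2 / 10) \<le> \<theta> * acc v (Suc K) w" using True \<theta> by (intro mult_left_mono) auto
      moreover have "\<theta> * (R\<^sup>2 / 10) = 12 / 10 * L" using R by (simp add: \<theta>_def)
      ultimately have "L \<le> \<theta> * acc v (Suc K) w - L / 40" using L by simp
      then have "ennreal (exp L) \<le> \<Phi> (Suc K) (state (Suc K) w, acc v (Suc K) w)"
        unfolding \<Phi>_def t by (simp flip: ennreal_mult exp_add add: ennreal_leI)
      then show ?thesis by (simp split: split_indicator)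
    qed simp
  qed
  also have "\<dots> \<le> 1" by (rule le1)
  finally have "ennreal (exp L * prob {w \<in> space M. R\<^sup>2 / 10 \<le> acc v (Suc K) w}) \<le> 1"
    by (simp add: emeasure_eq_measure ennreal_mult)
  then have "exp L * prob {w \<in> space M. R\<^sup>2 / 10 \<le> acc v (Suc K) w} \<le> 1" by simp
  then show ?thesis by (simp add: exp_minus field_simps)
qed

text \<open>The selection \<open>proj\<close> need not be measurable, so directions built from it give no martingale;
  a slack \<open>\<delta>\<close> allows a measurable choice from a countable dense set of solutions.\<close>
lemma near_projection:
  assumes \<delta>: "0 < \<delta>"
  obtains pt where "pt \<in> borel_measurable borel" and
    "\<And>x. norm (x - xstar) \<le> 2 * R \<Longrightarrow> pt x \<in> solution_set F"
    "\<And>x. norm (x - xstar) \<le> 2 * R \<Longrightarrow> (norm (x - pt x))\<^sup>2 \<le> (infdist x (solution_set F))\<^sup>2 + \<delta>"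
    "\<And>x. norm (x - xstar) \<le> 2 * R \<Longrightarrow> (norm (F x))\<^sup>2 / l - \<delta> \<le> F x \<bullet> (x - pt x)"
proof -
  let ?S = "solution_set F"
  obtain T where T: "countable T" "T \<subseteq> ?S" "?S \<subseteq> closure T"
    using separable[of ?S] by metis
  have "xstar \<in> ?S" using F_xstar by (simp add: solution_set_def)
  then have T0: "T \<noteq> {}" and S0: "?S \<noteq> {}" using T by auto
  define t where "t = from_nat_into T"
  have range_t: "range t = T" using T T0 by (simp add: t_def range_from_nat_into)
  \<comment> \<open>Strict inequalities make \<open>P x\<close> an open condition on the point. It
    holds at \<open>proj x\<close>, hence at some member of the dense \<open>T\<close>, and taking
    the first such index is a measurable choice.\<close>
  define P where "P = (\<lambda>x p. (norm (x - p))\<^sup>2 < (infdist x ?S)\<^sup>2 + \<delta> \<and> (norm (F x))\<^sup>2 / l - \<delta> < F x \<bullet> (x - p))"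
  define pt where "pt = (\<lambda>x. t (LEAST n. P x (t n)))"
  have [measurable]: "(\<lambda>x. infdist x ?S) \<in> borel_measurable borel"
    by (intro borel_measurable_continuous_onI continuous_intros)
  have [measurable]: "Measurable.pred borel (\<lambda>x. P x (t n))" for n
    unfolding P_def by measurable
  have "(\<lambda>x. LEAST n. P x (t n)) \<in> borel \<rightarrow>\<^sub>M count_space UNIV" by measurable
  then have "pt \<in> borel_measurable borel"
    unfolding pt_def by (rule measurable_compose) simp
  moreover have "pt x \<in> ?S \<and> P x (pt x)" if x: "norm (x - xstar) \<le> 2 * R" for x
  proof -
    have p: "proj x \<in> ?S" "\<And>y. y \<in> ?S \<Longrightarrow> dist x (proj x) \<le> dist x y"
      using proj[OF x] by (auto simp: is_projection_def)
    have "dist x (proj x) \<le> infdist x ?S"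
      using S0 p by (auto simp: infdist_notempty intro!: cINF_greatest)
    then have "(norm (x - proj x))\<^sup>2 \<le> (infdist x ?S)\<^sup>2"
      by (intro power_mono) (auto simp: dist_norm)
    moreover have "(norm (F x))\<^sup>2 / l \<le> F x \<bullet> (x - proj x)"
      using cocoercive[OF x] l by (simp add: field_simps)
    ultimately have "P x (proj x)" using \<delta> by (simp add: P_def)
    moreover have "open (Collect (P x))"
      unfolding P_def by (intro open_Collect_conj open_Collect_less continuous_intros)
    ultimately have "Collect (P x) \<inter> T \<noteq> {}"
      using p(1) T(3) open_Int_closure_eq_empty[of "Collect (P x)" T] by blast
    then obtain n where "P x (t n)" using range_t by auto
    then have "P x (pt x)" unfolding pt_def by (rule LeastI)
    then show ?thesis using range_t T by (auto simp: pt_def)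
  qed
  ultimately show thesis by (intro that[of pt]) (auto simp: P_def less_imp_le)
qed

section \<open>Recursions for the three potentials\<close>

text \<open>When the squared distance of the next iterate to \<open>u\<close> is expanded, the noise
  is paired with \<open>x - u - \<gamma> *\<^sub>R F x\<close>. Here \<open>u\<close> is
  \<open>xstar\<close>, and in \<open>proj_dir\<close> it is the near-projection of
  \<open>x\<close>.\<close>

definition sol_dir :: "'a \<times> 'a \<Rightarrow> 'a" where
  "sol_dir p = fst p - xstar - \<gamma> *\<^sub>R F (fst p)"

definition proj_dir :: "('a \<Rightarrow> 'a) \<Rightarrow> 'a \<times> 'a \<Rightarrow> 'a" where
  "proj_dir pt p = fst p - pt (fst p) - \<gamma> *\<^sub>R F (fst p)"

lemma state_Suc_good:
  assumes "good (state k w)"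
  defines "e \<equiv> noise k (fst (state k w)) (batch k w)"
  shows "fst (state (Suc k) w) = fst (state k w) - \<gamma> *\<^sub>R F (fst (state k w)) + \<gamma> *\<^sub>R e"
    and "snd (state (Suc k) w) = snd (state k w) + \<gamma> *\<^sub>R e"
    and "acc v (Suc k) w = acc v k w + (2 * \<gamma> * (e \<bullet> v (state k w)) + \<gamma>\<^sup>2 * (norm e)\<^sup>2)"
  using assms by (auto simp: step_def noise_def acc_def incr_def algebra_simps)

text \<open>The noise direction for a general \<open>u\<close> is \<open>sol_dir\<close> plus the
  constant vector \<open>xstar - u\<close>, and the contributions of the latter add up to the
  accumulated noise \<open>snd\<close>. So \<open>u\<close> meets the noise only in the last term,
  which Cauchy-Schwarz bounds for all \<open>u\<close> at once.\<close>

lemma norm_state_identity: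
  assumes "\<And>j. j < n \<Longrightarrow> good (state j w)"
  shows "(norm (fst (state n w) - u))\<^sup>2 = (norm (x0 - u))\<^sup>2
    - 2 * \<gamma> * (\<Sum>j<n. F (fst (state j w)) \<bullet> (fst (state j w) - u))
    + \<gamma>\<^sup>2 * (\<Sum>j<n. (norm (F (fst (state j w))))\<^sup>2)
    + acc sol_dir n w + 2 * (snd (state n w) \<bullet> (xstar - u))"
  using assms
proof (induction n)
  case 0
  then show ?case by (simp add: acc_def)
next
  case (Suc n)
  define x e f where "x = fst (state n w)" and "e = noise n (fst (state n w)) (batch n w)"
    and "f = F (fst (state n w))"
  have good: "good (state n w)" using Suc.prems by simp
  have "(norm (x - \<gamma> *\<^sub>R f + \<gamma> *\<^sub>R e - u))\<^sup>2 = (norm (x - u))\<^sup>2 - 2 * \<gamma> * (f \<bullet> (x - u)) + \<gamma>\<^sup>2 * (norm f)\<^sup>2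
      + (2 * \<gamma> * (e \<bullet> (x - xstar - \<gamma> *\<^sub>R f)) + \<gamma>\<^sup>2 * (norm e)\<^sup>2) + 2 * ((\<gamma> *\<^sub>R e) \<bullet> (xstar - u))"
    unfolding power2_norm_eq_inner
    by (simp add: inner_commute algebra_simps power2_eq_square)
  then show ?case
    using Suc.IH Suc.prems
    by (simp add: state_Suc_good[OF good] sol_dir_def x_def e_def f_def algebra_simps inner_add_left del: state.simps)
qed

text \<open>Each step compares with the near-projection of the current iterate, at a cost of
  \<open>\<delta>\<close> in the distance and \<open>2 * \<gamma> * \<delta>\<close> in the
  cocoercivity bound. The sum of squared operator norms on the left is the gain.\<close>

lemma infdist_state_le:
  assumes "\<And>j. j < n \<Longrightarrow> good (state j w)" and \<delta>: "0 \<le> \<delta>"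
    and pt: "\<And>x. norm (x - xstar) \<le> 2 * R \<Longrightarrow> pt x \<in> solution_set F"
    "\<And>x. norm (x - xstar) \<le> 2 * R \<Longrightarrow> (norm (x - pt x))\<^sup>2 \<le> (infdist x (solution_set F))\<^sup>2 + \<delta>"
    "\<And>x. norm (x - xstar) \<le> 2 * R \<Longrightarrow> (norm (F x))\<^sup>2 / l - \<delta> \<le> F x \<bullet> (x - pt x)"
  shows "(infdist (fst (state n w)) (solution_set F))\<^sup>2
      + 339 * (\<gamma>\<^sup>2 * (\<Sum>j<n. (norm (F (fst (state j w))))\<^sup>2))
    \<le> R\<^sup>2 + real n * (\<delta> * (1 + 2 * \<gamma>)) + acc (proj_dir pt) n w"
  using assms(1)
proof (induction n)
  case 0
  have "infdist x0 (solution_set F) \<le> R"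
    using x0_xstar F_xstar by (intro infdist_le2[of xstar]) (auto simp: solution_set_def dist_norm)
  then have "(infdist x0 (solution_set F))\<^sup>2 \<le> R\<^sup>2" by (intro power_mono infdist_nonneg)
  then show ?case by (simp add: acc_def)
next
  case (Suc n)
  define x e f p where "x = fst (state n w)" and "e = noise n (fst (state n w)) (batch n w)"
    and "f = F (fst (state n w))" and "p = pt (fst (state n w))"
  have good: "good (state n w)" using Suc.prems by simp
  note x = good_D(1)[OF good]
  have "infdist (fst (state (Suc n) w)) (solution_set F) \<le> norm (x - \<gamma> *\<^sub>R f + \<gamma> *\<^sub>R e - p)"
    using infdist_le[OF pt(1)[OF x]]
    by (simp add: state_Suc_good[OF good] x_def e_def f_def p_def dist_norm del: state.simps)
  then have "(infdist (fst (state (Suc n) w)) (solution_set F))\<^sup>2 \<le> (norm (x - \<gamma> *\<^sub>R f + \<gamma> *\<^sub>R e - p))\<^sup>2"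
    by (intro power_mono infdist_nonneg)
  also have "\<dots> = (norm (x - p))\<^sup>2 - 2 * \<gamma> * (f \<bullet> (x - p)) + \<gamma>\<^sup>2 * (norm f)\<^sup>2
      + (2 * \<gamma> * (e \<bullet> (x - p - \<gamma> *\<^sub>R f)) + \<gamma>\<^sup>2 * (norm e)\<^sup>2)"
    unfolding power2_norm_eq_inner
    by (simp add: inner_commute algebra_simps power2_eq_square)
  also have "2 * \<gamma> * (e \<bullet> (x - p - \<gamma> *\<^sub>R f)) + \<gamma>\<^sup>2 * (norm e)\<^sup>2 = acc (proj_dir pt) (Suc n) w - acc (proj_dir pt) n w"
    by (simp add: state_Suc_good(3)[OF good] proj_dir_def x_def e_def f_def p_def del: state.simps)
  finally have "(infdist (fst (state (Suc n) w)) (solution_set F))\<^sup>2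
    \<le> (norm (x - p))\<^sup>2 - 2 * \<gamma> * (f \<bullet> (x - p)) + \<gamma>\<^sup>2 * (norm f)\<^sup>2 + (acc (proj_dir pt) (Suc n) w - acc (proj_dir pt) n w)" .
  moreover have "(norm (x - p))\<^sup>2 \<le> (infdist x (solution_set F))\<^sup>2 + \<delta>"
    using pt(2)[OF x] by (simp add: x_def p_def)
  moreover have "2 * \<gamma> * ((norm f)\<^sup>2 / l - \<delta>) \<le> 2 * \<gamma> * (f \<bullet> (x - p))"
    using pt(3)[OF x] \<gamma> by (intro mult_left_mono) (auto simp: x_def p_def f_def)
  \<comment> \<open>Cocoercivity yields \<open>2 * \<gamma> / l\<close>, at least
    \<open>340 * \<gamma>\<^sup>2\<close> by the stepsize; the quadratic term of the expansion takes
    one unit back, whence \<open>339\<close>.\<close>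
  moreover have "340 * (\<gamma>\<^sup>2 * (norm f)\<^sup>2) \<le> 2 * \<gamma> * (norm f)\<^sup>2 / l"
  proof -
    have "\<gamma> * (\<gamma> * l) \<le> \<gamma> * (1 / 170)" using \<gamma>l \<gamma> by (intro mult_left_mono) auto
    then have "340 * \<gamma>\<^sup>2 \<le> 2 * \<gamma> / l" using l by (simp add: field_simps power2_eq_square)
    from mult_right_mono[OF this, of "(norm f)\<^sup>2"] show ?thesis by (simp add: mult_ac)
  qed
  ultimately show ?case
    using Suc.IH Suc.prems
    by (simp add: x_def f_def algebra_simps del: state.simps)
qed

lemma norm_snd_state:
  assumes "\<And>j. j < n \<Longrightarrow> good (state j w)"
  shows "(norm (snd (state n w)))\<^sup>2 = acc snd n w"
  using assms
proof (induction n)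
  case 0
  then show ?case by (simp add: acc_def)
next
  case (Suc n)
  have good: "good (state n w)" using Suc.prems by simp
  have *: "(norm (y + \<gamma> *\<^sub>R e))\<^sup>2 = (norm y)\<^sup>2 + (2 * \<gamma> * (e \<bullet> y) + \<gamma>\<^sup>2 * (norm e)\<^sup>2)" for y e :: 'a
    unfolding power2_norm_eq_inner by (simp add: inner_commute algebra_simps power2_eq_square)
  show ?case using Suc by (simp add: state_Suc_good[OF good] * del: state.simps)
qed

text \<open>Through this, bounds on \<open>acc\<close> at the final time become bounds at the first
  exit from the good region.\<close>

lemma state_frozen:
  assumes "\<not> good (state n w)" "n \<le> k"
  shows "state k w = state n w \<and> acc v k w = acc v n w"
  using assms(2)
proof (induction k rule: dec_induct)
  case (step k)
  then show ?case using assms(1) by (simp add: step_def acc_def incr_def)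
qed simp

text \<open>Only the states before \<open>n\<close> have to be good: the move that leaves the region
  is still a genuine step of the algorithm.\<close>

lemma clipped_sgda_eq_state:
  assumes "\<And>j. j < n \<Longrightarrow> good (state j w)"
  shows "clipped_sgda Fo \<gamma> (\<lambda>_. c) (\<lambda>_. m0) \<xi> x0 n w = fst (state n w)"
  using assms
proof (induction n)
  case (Suc n)
  have "mean n x (batch n w) = (1 / real m0) *\<^sub>R (\<Sum>i = 1..m0. Fo (\<xi> i n w) x)" for x
  proof -
    have "{n} \<times> {1..m0} = Pair n ` {1..m0}" by auto
    then have "(\<Sum>p\<in>{n} \<times> {1..m0}. Fo (batch n w p) x) = (\<Sum>i = 1..m0. Fo (batch n w (n, i)) x)"
      by (simp add: sum.reindex inj_on_def)
    then show ?thesis by (simp add: mean_def batch_def)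
  qed
  then show ?case using Suc by (simp add: step_def Let_def)
qed simp

section \<open>No exit from the good region, and the resulting gap bound\<close>

text \<open>Over \<open>Suc K\<close> steps the slack \<open>\<delta> * (1 + 2 * \<gamma>)\<close>
  amounts to \<open>R\<^sup>2 / 100\<close>.\<close>

definition \<delta> :: real where "\<delta> = R\<^sup>2 / (100 * real (Suc K) * (1 + 2 * \<gamma>))"

lemma \<delta>: "0 < \<delta>" "\<delta> \<le> R\<^sup>2 / 100" "n \<le> Suc K \<Longrightarrow> real n * (\<delta> * (1 + 2 * \<gamma>)) \<le> R\<^sup>2 / 100"
proof -
  show "0 < \<delta>" using R \<gamma> by (simp add: \<delta>_def)
  have "1 * 1 \<le> real (Suc K) * (1 + 2 * \<gamma>)" using \<gamma> by (intro mult_mono) auto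
  then have "R\<^sup>2 / (100 * (real (Suc K) * (1 + 2 * \<gamma>))) \<le> R\<^sup>2 / (100 * 1)"
    by (intro divide_left_mono) auto
  then show "\<delta> \<le> R\<^sup>2 / 100" by (simp only: \<delta>_def mult.assoc mult_1_right)
  have eq: "\<delta> * (1 + 2 * \<gamma>) = R\<^sup>2 / (100 * real (Suc K))"
    using \<gamma> by (simp add: \<delta>_def)
  assume "n \<le> Suc K"
  then have "real n * (R\<^sup>2 / (100 * real (Suc K))) \<le> real (Suc K) * (R\<^sup>2 / (100 * real (Suc K)))"
    by (intro mult_right_mono) auto
  then show "real n * (\<delta> * (1 + 2 * \<gamma>)) \<le> R\<^sup>2 / 100" unfolding eq by (simp del: of_nat_Suc)
qed

text \<open>\<open>3 / 2 * R\<close> is the bound on directions for which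
  \<open>incr_exp_moment\<close> is tuned. For \<open>proj_dir\<close> it splits into
  \<open>7 / 5 * R\<close> for the distance to the near-projection and \<open>R / 100\<close> for
  the operator.\<close>

lemma v_bounds:
  assumes p: "good p"
  shows "norm (sol_dir p) \<le> 3 / 2 * R"
    and "(\<And>x. norm (x - xstar) \<le> 2 * R \<Longrightarrow>
        (norm (x - pt x))\<^sup>2 \<le> (infdist x (solution_set F))\<^sup>2 + \<delta>) \<Longrightarrow> norm (proj_dir pt p) \<le> 3 / 2 * R"
    and "norm (snd p) \<le> 3 / 2 * R"
proof -
  note x = good_D[OF p]
  have g: "norm (fst p - xstar) \<le> 5 / 4 * R" "norm (snd p) \<le> R" using p by (auto simp: good_def)
  have F: "norm (\<gamma> *\<^sub>R F (fst p)) \<le> R / 100" using x(3) \<gamma> by simp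
  show "norm (sol_dir p) \<le> 3 / 2 * R"
    unfolding sol_dir_def
    using norm_triangle_ineq4[of "fst p - xstar" "\<gamma> *\<^sub>R F (fst p)"] g(1) F R by linarith
  show "norm (snd p) \<le> 3 / 2 * R" using g R by simp
  assume pt: "\<And>x. norm (x - xstar) \<le> 2 * R \<Longrightarrow>
        (norm (x - pt x))\<^sup>2 \<le> (infdist x (solution_set F))\<^sup>2 + \<delta>"
  have "infdist (fst p) (solution_set F) \<le> 5 / 4 * R"
    using g F_xstar by (intro infdist_le2[of xstar]) (auto simp: solution_set_def dist_norm)
  then have "(infdist (fst p) (solution_set F))\<^sup>2 \<le> (5 / 4 * R)\<^sup>2"
    by (intro power_mono infdist_nonneg)
  then have "(norm (fst p - pt (fst p)))\<^sup>2 \<le> (5 / 4 * R)\<^sup>2 + R\<^sup>2 / 100"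
    using pt[OF x(1)] \<delta>(2) by linarith
  also have "\<dots> \<le> (7 / 5 * R)\<^sup>2"
  proof -
    have "(5 / 4 * R)\<^sup>2 = 25 / 16 * R\<^sup>2" "(7 / 5 * R)\<^sup>2 = 49 / 25 * R\<^sup>2"
      by (simp_all add: power2_eq_square)
    then show ?thesis using zero_le_power2[of R] by linarith
  qed
  finally have "norm (fst p - pt (fst p)) \<le> 7 / 5 * R"
    by (rule power2_le_imp_le) (use R in simp)
  then show "norm (proj_dir pt p) \<le> 3 / 2 * R"
    unfolding proj_dir_def
    using norm_triangle_ineq4[of "fst p - pt (fst p)" "\<gamma> *\<^sub>R F (fst p)"] F R by linarith
qed

text \<open>At a first bad time all earlier states are good, so the potential bounds hold at that
  time too and put the state back into the region.\<close>

lemma good_state: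
  assumes pt: "\<And>x. norm (x - xstar) \<le> 2 * R \<Longrightarrow> pt x \<in> solution_set F"
    "\<And>x. norm (x - xstar) \<le> 2 * R \<Longrightarrow> (norm (x - pt x))\<^sup>2 \<le> (infdist x (solution_set F))\<^sup>2 + \<delta>"
    "\<And>x. norm (x - xstar) \<le> 2 * R \<Longrightarrow> (norm (F x))\<^sup>2 / l - \<delta> \<le> F x \<bullet> (x - pt x)"
    and acc: "acc sol_dir (Suc K) w < R\<^sup>2 / 10" "acc (proj_dir pt) (Suc K) w < R\<^sup>2 / 10"
      "acc snd (Suc K) w < R\<^sup>2 / 10"
    and n: "n \<le> Suc K"
  shows "good (state n w)"
  using n
proof (induction n rule: less_induct)
  case (less n)
  then have good: "\<And>j. j < n \<Longrightarrow> good (state j w)" by simp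
  show ?case
  proof (rule ccontr)
    assume bad: "\<not> good (state n w)"
    then have acc: "acc sol_dir n w < R\<^sup>2 / 10" "acc (proj_dir pt) n w < R\<^sup>2 / 10" "acc snd n w < R\<^sup>2 / 10"
      using acc state_frozen[OF bad less.prems] by auto
    have R2: "0 < R\<^sup>2" using R by simp
    define G where "G = \<gamma>\<^sup>2 * (\<Sum>j<n. (norm (F (fst (state j w))))\<^sup>2)"
    \<comment> \<open>The bound on the distance to the solution set, whose own square is dropped;
      this keeps \<open>G\<close> small without comparing with \<open>xstar\<close>.\<close>
    have "339 * G \<le> R\<^sup>2 + R\<^sup>2 / 100 + R\<^sup>2 / 10"
      using infdist_state_le[where n = n and w = w, OF good less_imp_le[OF \<delta>(1)] pt] \<delta>(3)[OF less.prems] acc(2)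
        zero_le_power2[of "infdist (fst (state n w)) (solution_set F)"]
      unfolding G_def by linarith
    then have G: "G \<le> R\<^sup>2 / 100" using R2 by linarith
    \<comment> \<open>Monotonicity against \<open>xstar\<close>, where \<open>F\<close> vanishes,
      lets the sum in the identity be discarded.\<close>
    have "0 \<le> F x \<bullet> (x - xstar)" if "norm (x - xstar) \<le> 2 * R" for x
      using monotone[OF that, of xstar] F_xstar R by simp
    then have "0 \<le> 2 * \<gamma> * (\<Sum>j<n. F (fst (state j w)) \<bullet> (fst (state j w) - xstar))"
      using good_D(1)[OF good] \<gamma> by (intro mult_nonneg_nonneg sum_nonneg) auto
    moreover have "(norm (x0 - xstar))\<^sup>2 \<le> R\<^sup>2" using x0_xstar by (intro power_mono) auto
    ultimately have "(norm (fst (state n w) - xstar))\<^sup>2 \<le> R\<^sup>2 + R\<^sup>2 / 100 + R\<^sup>2 / 10"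
      using norm_state_identity[OF good, where u = xstar] G acc(1) unfolding G_def by simp
    also have "\<dots> \<le> (5 / 4 * R)\<^sup>2"
    proof -
      have "(5 / 4 * R)\<^sup>2 = 25 / 16 * R\<^sup>2" by (simp add: power2_eq_square)
      then show ?thesis using R2 by linarith
    qed
    finally have "norm (fst (state n w) - xstar) \<le> 5 / 4 * R"
      by (rule power2_le_imp_le) (use R in simp)
    moreover have "(norm (snd (state n w)))\<^sup>2 \<le> R\<^sup>2"
      using norm_snd_state[where n = n and w = w, OF good] acc(3) R2 by linarith
    then have "norm (snd (state n w)) \<le> R" by (rule power2_le_imp_le) (use R in simp)
    ultimately show False using bad by (simp add: good_def)
  qed
qed

text \<open>For each \<open>u\<close> in the ball, \<open>norm_state_identity\<close> bounds the sum
  of \<open>F (x j) \<bullet> (x j - u)\<close>; monotonicity moves the operator from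
  \<open>x j\<close> to \<open>u\<close>, and linearity in \<open>x j\<close> then passes to the
  average.\<close>

lemma gap_le:
  assumes pt: "\<And>x. norm (x - xstar) \<le> 2 * R \<Longrightarrow> pt x \<in> solution_set F"
    "\<And>x. norm (x - xstar) \<le> 2 * R \<Longrightarrow> (norm (x - pt x))\<^sup>2 \<le> (infdist x (solution_set F))\<^sup>2 + \<delta>"
    "\<And>x. norm (x - xstar) \<le> 2 * R \<Longrightarrow> (norm (F x))\<^sup>2 / l - \<delta> \<le> F x \<bullet> (x - pt x)"
    and acc: "acc sol_dir (Suc K) w < R\<^sup>2 / 10" "acc (proj_dir pt) (Suc K) w < R\<^sup>2 / 10"
      "acc snd (Suc K) w < R\<^sup>2 / 10"
  shows "gap F xstar R (sgda_avg Fo \<gamma> (\<lambda>_. c) (\<lambda>_. m0) \<xi> x0 K w) \<le> 9 * R\<^sup>2 / (2 * \<gamma> * real (K + 1))"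
proof -
  note good = good_state[OF pt acc]
  define x where "x = (\<lambda>j. fst (state j w))"
  have avg: "sgda_avg Fo \<gamma> (\<lambda>_. c) (\<lambda>_. m0) \<xi> x0 K w = (1 / real (Suc K)) *\<^sub>R (\<Sum>j<Suc K. x j)"
  proof -
    have "clipped_sgda Fo \<gamma> (\<lambda>_. c) (\<lambda>_. m0) \<xi> x0 j w = x j" if "j \<le> K" for j
      unfolding x_def using that by (intro clipped_sgda_eq_state good) auto
    then show ?thesis unfolding sgda_avg_def
      by (simp add: atLeast0AtMost lessThan_Suc_atMost del: sum.lessThan_Suc sum.atMost_Suc)
  qed
  have R2: "0 < R\<^sup>2" using R by simp
  define G where "G = \<gamma>\<^sup>2 * (\<Sum>j<Suc K. (norm (F (fst (state j w))))\<^sup>2)"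
  have "339 * G \<le> R\<^sup>2 + R\<^sup>2 / 100 + R\<^sup>2 / 10"
    using infdist_state_le[OF good less_imp_le[OF \<delta>(1)] pt, of "Suc K"] \<delta>(3)[of "Suc K"] acc(2)
      zero_le_power2[of "infdist (fst (state (Suc K) w)) (solution_set F)"]
    unfolding G_def by linarith
  then have G: "G \<le> R\<^sup>2 / 100" using R2 by linarith
  have "F u \<bullet> ((1 / real (Suc K)) *\<^sub>R (\<Sum>j<Suc K. x j) - u) \<le> 9 * R\<^sup>2 / (2 * \<gamma> * real (K + 1))"
    if u: "norm (u - xstar) \<le> R" for u
  proof -
    have "(norm (x0 - u))\<^sup>2 \<le> (2 * R)\<^sup>2"
      using norm_triangle_ineq4[of "x0 - xstar" "u - xstar"] x0_xstar u by (intro power_mono) auto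
    moreover have "snd (state (Suc K) w) \<bullet> (xstar - u) \<le> R * R"
    proof -
      have "norm (snd (state (Suc K) w)) \<le> R" using good[of "Suc K"] by (auto simp: good_def)
      then have "norm (snd (state (Suc K) w)) * norm (xstar - u) \<le> R * R"
        using u R by (intro mult_mono) (auto simp: norm_minus_commute)
      then show ?thesis using norm_cauchy_schwarz[of "snd (state (Suc K) w)" "xstar - u"] by linarith
    qed
    \<comment> \<open>The terms are \<open>4\<close> for the starting distance,
      \<open>1 / 100\<close> for \<open>G\<close>, less than \<open>1 / 10\<close> for
      \<open>acc sol_dir\<close> and \<open>2\<close> for the accumulated noise, in units of
      \<open>R\<^sup>2\<close>; their total is below \<open>9\<close>.\<close>
    ultimately have sum: "2 * \<gamma> * (\<Sum>j<Suc K. F (x j) \<bullet> (x j - u)) \<le> 9 * R\<^sup>2"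
      using norm_state_identity[OF good, where u = u, of "Suc K"] G acc(1) R2
        zero_le_power2[of "norm (fst (state (Suc K) w) - u)"]
      unfolding G_def x_def by (simp add: power2_eq_square del: sum.lessThan_Suc state.simps)
    have "F u \<bullet> ((1 / real (Suc K)) *\<^sub>R (\<Sum>j<Suc K. x j) - u) = (\<Sum>j<Suc K. F u \<bullet> (x j - u)) / real (Suc K)"
    proof -
      have "(\<Sum>j<Suc K. F u \<bullet> (x j - u)) = F u \<bullet> (\<Sum>j<Suc K. x j) - real (Suc K) * (F u \<bullet> u)"
        by (simp add: inner_diff_right sum_subtractf inner_sum_right del: sum.lessThan_Suc)
      then show ?thesis
        by (simp add: inner_diff_right diff_divide_distrib del: sum.lessThan_Suc of_nat_Suc)
    qed
    also have "(\<Sum>j<Suc K. F u \<bullet> (x j - u)) \<le> (\<Sum>j<Suc K. F (x j) \<bullet> (x j - u))"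
    proof (intro sum_mono)
      fix j assume "j \<in> {..<Suc K}"
      then have "norm (x j - xstar) \<le> 2 * R" unfolding x_def by (intro good_D(1) good) auto
      then show "F u \<bullet> (x j - u) \<le> F (x j) \<bullet> (x j - u)"
        using monotone[of "x j" u] u R by (simp add: inner_diff_left)
    qed
    also have "\<dots> \<le> 9 * R\<^sup>2 / (2 * \<gamma>)" using sum \<gamma> by (simp add: field_simps)
    finally show ?thesis by (simp add: divide_right_mono)
  qed
  then show ?thesis
    unfolding gap_def avg using R
    by (intro cSUP_least) (auto simp: dist_norm norm_minus_commute)
qed

section \<open>Measurability of the gap event and the union bound\<close>

text \<open>The growth bound on \<open>F\<close> makes the family bounded above on the ball, so the
  real supremum is a true least upper bound.\<close>

lemma gap_le_iff:
  "gap F xstar R x \<le> a \<longleftrightarrow> (\<forall>u\<in>cball xstar R. F u \<bullet> (x - u) \<le> a)"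
proof -
  have "F u \<bullet> (x - u) \<le> l * R * (norm (x - xstar) + R)" if "u \<in> cball xstar R" for u
  proof -
    have u: "norm (u - xstar) \<le> R" using that by (simp add: dist_norm norm_minus_commute)
    have "norm (F u) \<le> l * norm (u - xstar)" using u R by (intro norm_F_le) auto
    also have "\<dots> \<le> l * R" using u l by simp
    finally have "norm (F u) * norm (x - u) \<le> l * R * (norm (x - xstar) + R)"
      using norm_triangle_ineq4[of "x - xstar" "u - xstar"] u l R by (intro mult_mono) auto
    then show ?thesis using norm_cauchy_schwarz[of "F u" "x - u"] by linarith
  qed
  then have "bdd_above ((\<lambda>u. F u \<bullet> (x - u)) ` cball xstar R)" by (rule bdd_aboveI2)
  then show ?thesis unfolding gap_def using R by (intro cSUP_le_iff) auto
qed

lemma clipped_sgda_measurable [measurable]: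
  "clipped_sgda Fo \<gamma> (\<lambda>_. c) (\<lambda>_. m0) \<xi> x0 n \<in> borel_measurable M"
proof (induction n)
  case 0
  then show ?case by (simp add: clipped_sgda.simps(1)[abs_def])
next
  case (Suc n)
  have "(\<lambda>w. (\<lambda>(z, x). Fo z x) (\<xi> i n w, clipped_sgda Fo \<gamma> (\<lambda>_. c) (\<lambda>_. m0) \<xi> x0 n w)) \<in> borel_measurable M"
    if "i \<in> {1..m0}" for i
    by (rule measurable_compose[OF measurable_Pair oracle_measurable]) (rule \<xi>_measurable[OF that], rule Suc)
  then have "(\<lambda>w. \<Sum>i=1..m0. Fo (\<xi> i n w) (clipped_sgda Fo \<gamma> (\<lambda>_. c) (\<lambda>_. m0) \<xi> x0 n w)) \<in> borel_measurable M"
    by (intro borel_measurable_sum) auto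
  note [measurable] = this Suc
  show ?case unfolding clipped_sgda.simps(2)[abs_def] Let_def by measurable
qed

text \<open>A sublevel set of the gap is an intersection of closed sets, one for each
  \<open>u\<close>. It is closed although the intersection is uncountable and \<open>F\<close> may
  be discontinuous.\<close>

lemma gap_event_measurable:
  "{w \<in> space M. gap F xstar R (sgda_avg Fo \<gamma> (\<lambda>_. c) (\<lambda>_. m0) \<xi> x0 K w) \<le> a} \<in> events"
proof -
  have "{x. gap F xstar R x \<le> a} = (\<Inter>u\<in>cball xstar R. {x. F u \<bullet> (x - u) \<le> a})"
    by (auto simp: gap_le_iff)
  also have "closed \<dots>" by (intro closed_INT ballI closed_Collect_le continuous_intros)
  finally have [measurable]: "{x. gap F xstar R x \<le> a} \<in> sets borel" by (rule borel_closed)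
  have "sgda_avg Fo \<gamma> (\<lambda>_. c) (\<lambda>_. m0) \<xi> x0 K \<in> borel_measurable M"
    unfolding sgda_avg_def[abs_def] by measurable
  then have "sgda_avg Fo \<gamma> (\<lambda>_. c) (\<lambda>_. m0) \<xi> x0 K -` {x. gap F xstar R x \<le> a} \<inter> space M \<in> events"
    by (rule measurable_sets) measurable
  then show ?thesis by (simp add: vimage_def Int_def conj_commute)
qed

lemma gap_high_probability:
  "1 - 3 * exp (- L) \<le> prob {w \<in> space M. gap F xstar R (sgda_avg Fo \<gamma> (\<lambda>_. c) (\<lambda>_. m0) \<xi> x0 K w)
      \<le> 9 * R\<^sup>2 / (2 * \<gamma> * real (K + 1))}" (is "_ \<le> prob ?A")
proof -
  obtain pt where [measurable]: "pt \<in> borel_measurable borel" and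
    pt: "\<And>x. norm (x - xstar) \<le> 2 * R \<Longrightarrow> pt x \<in> solution_set F"
    "\<And>x. norm (x - xstar) \<le> 2 * R \<Longrightarrow> (norm (x - pt x))\<^sup>2 \<le> (infdist x (solution_set F))\<^sup>2 + \<delta>"
    "\<And>x. norm (x - xstar) \<le> 2 * R \<Longrightarrow> (norm (F x))\<^sup>2 / l - \<delta> \<le> F x \<bullet> (x - pt x)"
    using near_projection[OF \<delta>(1)] by metis
  define B where "B = (\<lambda>v. {w \<in> space M. R\<^sup>2 / 10 \<le> acc v (Suc K) w})"
  have v[measurable]: "sol_dir \<in> borel_measurable (borel \<Otimes>\<^sub>M borel)" "proj_dir pt \<in> borel_measurable (borel \<Otimes>\<^sub>M borel)"
    unfolding sol_dir_def proj_dir_def by measurable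
  have B: "B v \<in> events" if [measurable]: "v \<in> borel_measurable (borel \<Otimes>\<^sub>M borel)" for v
    unfolding B_def by measurable
  have tail: "prob (B sol_dir) \<le> exp (- L)" "prob (B (proj_dir pt)) \<le> exp (- L)" "prob (B snd) \<le> exp (- L)"
    unfolding B_def
    by (rule acc_tail[OF v(1) v_bounds(1)], assumption)
      (rule acc_tail[OF v(2) v_bounds(2)[OF _ pt(2)]], assumption+,
       rule acc_tail[OF measurable_snd v_bounds(3)], assumption)
  \<comment> \<open>Contrapositive of \<open>gap_le\<close>: if the gap bound fails, some
    accumulated noise has reached its threshold.\<close>
  have "space M - ?A \<subseteq> B sol_dir \<union> B (proj_dir pt) \<union> B snd"
    using gap_le[OF pt] by (force simp: B_def not_le)
  then have "prob (space M - ?A) \<le> prob (B sol_dir \<union> B (proj_dir pt) \<union> B snd)"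
    using B v by (intro finite_measure_mono) auto
  also have "\<dots> \<le> prob (B sol_dir) + prob (B (proj_dir pt)) + prob (B snd)"
    using B v by (intro order_trans[OF measure_Un_le] add_right_mono measure_Un_le) auto
  also have "\<dots> \<le> 3 * exp (- L)" using tail by simp
  finally show ?thesis using prob_compl[OF gap_event_measurable] by simp
qed

end

theorem theoremD1:
  fixes D :: "'b measure" and M :: "'w measure"
    and Fo :: "'b \<Rightarrow> 'a::euclidean_space \<Rightarrow> 'a"
    and F proj :: "'a \<Rightarrow> 'a"
    and \<xi> :: "nat \<Rightarrow> nat \<Rightarrow> 'w \<Rightarrow> 'b"
    and x0 xstar :: 'a
    and Q :: "'a set"
    and R \<sigma> l \<gamma> \<beta> :: real
    and lam :: "nat \<Rightarrow> real" and m :: "nat \<Rightarrow> nat" and m0 K :: nat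
  assumes prob_D: "prob_space D"
    and prob_M: "prob_space M"
    and oracle_measurable: "(\<lambda>(z, x). Fo z x) \<in> borel_measurable (D \<Otimes>\<^sub>M borel)"
    and oracle_integrable: "\<And>x. integrable D (\<lambda>z. Fo z x)"
    and F_def: "\<And>x. F x = (\<integral>z. Fo z x \<partial>D)"
    and samples_indep: "prob_space.indep_vars M (\<lambda>_. D) (\<lambda>(k, i). \<xi> i k) (SIGMA k:UNIV. {1..m k})"
    and samples_distr: "\<And>k i. i \<in> {1..m k} \<Longrightarrow> distr M D (\<xi> i k) = D"
    and xstar: "is_projection (solution_set F) x0 xstar"
    and R: "norm (x0 - xstar) \<le> R"
    and Q_def: "Q = cball xstar (2 * R)"
    and bounded_variance:
      "\<And>x. x \<in> Q \<Longrightarrow> integrable D (\<lambda>z. (norm (Fo z x - F x))\<^sup>2) \<and>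
                     (\<integral>z. (norm (Fo z x - F x))\<^sup>2 \<partial>D) \<le> \<sigma>\<^sup>2"
    and monotonicity: "\<And>x y. x \<in> Q \<Longrightarrow> y \<in> Q \<Longrightarrow> (F x - F y) \<bullet> (x - y) \<ge> 0"
    and proj: "\<And>x. x \<in> Q \<Longrightarrow> is_projection (solution_set F) x (proj x)"
    and l: "l > 0"
    and star_cocoercivity: "\<And>x. x \<in> Q \<Longrightarrow> (norm (F x))\<^sup>2 \<le> l * (F x \<bullet> (x - proj x))"
    and \<beta>: "0 < \<beta>" "\<beta> \<le> 1"
    and log_ge_1: "ln (6 * real (K + 1) / \<beta>) \<ge> 1"
    and \<gamma>: "0 < \<gamma>" "\<gamma> \<le> 1 / (170 * l * ln (6 * real (K + 1) / \<beta>))"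
    and lam_pos: "\<And>k. lam k > 0"
    and lam: "\<And>k. lam k = R / (60 * \<gamma> * ln (6 * real (K + 1) / \<beta>))"
    and m: "\<And>k. m k = m0"
    and m0: "real m0 \<ge> max 1 (97200 * real (K + 1) * \<gamma>\<^sup>2 * \<sigma>\<^sup>2 * ln (6 * real (K + 1) / \<beta>) / R\<^sup>2)"
  shows "measure M {\<omega> \<in> space M.
           gap F xstar R (sgda_avg Fo \<gamma> lam m \<xi> x0 K \<omega>) \<le> 9 * R\<^sup>2 / (2 * \<gamma> * real (K + 1))}
         \<ge> 1 - \<beta>"
proof -
  define L where "L = ln (6 * real (K + 1) / \<beta>)"
  \<comment> \<open>Positivity of \<open>R\<close> comes from the positive clipping levels, which
    are positive multiples of \<open>R\<close>.\<close>
  have R_pos: "0 < R"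
  proof -
    have "0 < 60 * \<gamma> * L" using \<gamma>(1) log_ge_1 by (simp add: L_def)
    moreover have "0 < R / (60 * \<gamma> * L)" using lam_pos[of 0] unfolding lam L_def .
    ultimately show ?thesis by (simp only: zero_less_divide_iff) linarith
  qed
  have m_eq: "m = (\<lambda>_. m0)" and lam_eq: "lam = (\<lambda>_. R / (60 * \<gamma> * L))"
    using m lam by (auto simp: L_def)
  interpret prob_space M by (rule prob_M)
  interpret clipped_sgda_setting M D Fo F proj \<xi> x0 xstar R \<sigma> l \<gamma> L m0 K
  proof (intro clipped_sgda_setting.intro clipped_sgda_setting_axioms.intro)
    show "prob_space M" by (rule prob_M)
    show "prob_space D" by (rule prob_D)
    show "(\<lambda>(z, x). Fo z x) \<in> borel_measurable (D \<Otimes>\<^sub>M borel)" by (rule oracle_measurable)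
    show "indep_vars (\<lambda>_. D) (\<lambda>(k, i). \<xi> i k) (UNIV \<times> {1..m0})"
      using samples_indep unfolding m .
    show "F xstar = 0" using xstar by (simp add: is_projection_def solution_set_def)
    show "1 \<le> m0" "97200 * real (K + 1) * \<gamma>\<^sup>2 * \<sigma>\<^sup>2 * L / R\<^sup>2 \<le> real m0"
      using m0 by (auto simp: L_def)
    show "1 \<le> L" "\<gamma> \<le> 1 / (170 * l * L)" using log_ge_1 \<gamma>(2) by (simp_all only: L_def)
    show "integrable D (\<lambda>z. Fo z x)" "F x = (\<integral>z. Fo z x \<partial>D)" for x
      by (rule oracle_integrable, rule F_def)
    show "distr M D (\<xi> i k) = D" if "i \<in> {1..m0}" for i k
      using samples_distr that unfolding m by blast
    fix x y assume x: "norm (x - xstar) \<le> 2 * R"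
    then have xQ: "x \<in> Q" by (simp add: Q_def dist_norm norm_minus_commute)
    show "integrable D (\<lambda>z. (norm (Fo z x - F x))\<^sup>2)"
      "(\<integral>z. (norm (Fo z x - F x))\<^sup>2 \<partial>D) \<le> \<sigma>\<^sup>2"
      using bounded_variance[OF xQ] by auto
    show "is_projection (solution_set F) x (proj x)" by (rule proj[OF xQ])
    show "(norm (F x))\<^sup>2 \<le> l * (F x \<bullet> (x - proj x))" by (rule star_cocoercivity[OF xQ])
    assume "norm (y - xstar) \<le> 2 * R"
    then have "y \<in> Q" by (simp add: Q_def dist_norm norm_minus_commute)
    with xQ show "0 \<le> (F x - F y) \<bullet> (x - y)" by (rule monotonicity)
  qed (use R l \<gamma>(1) R_pos in simp_all)
  \<comment> \<open>Three bad events of probability at most \<open>\<beta> / 6\<close> each cost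
    \<open>\<beta> / 2\<close> in total, within the allowed \<open>\<beta>\<close>.\<close>
  have "exp (- L) = \<beta> / (6 * real (K + 1))"
    using \<beta> by (simp add: L_def exp_minus field_simps)
  also have "\<dots> \<le> \<beta> / 6" using \<beta> by (intro divide_left_mono) auto
  finally have "1 - \<beta> \<le> 1 - 3 * exp (- L)" using \<beta> by simp
  also note gap_high_probability
  finally show ?thesis unfolding m_eq lam_eq c_def .
qed

end
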